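(* For every $n\ge0$ the forward operator $K_n$ is a bounded multilinear operator from $[L^\infty(\Omega)]^{2n}=([L^\infty(\Omega)]^2)^n$ to $C^0(\overline\Omega\times\partial\Omega)$, and its bound satisfies $$|K_n|_\infty\le\nu(K\mu)^n,$$ where $\mu=k^2\sup_{x\in\Omega}\int_\Omega|G(x,y)|\,dy$ and $\nu,K$ are constants, depending on $\nu_0=\|u_0\|_{C(\overline\Omega\times\partial\Omega)}$ but not on $n$, such that $\nu_n\le\nu K^n$ for all $n\ge0$, the sequence $\{\nu_n\}$ being defined by its initial value $\nu_0$ and $$\nu_{n+1}=\nu_n+\sum_{\substack{(i_1,i_2,i_3)\\ i_1+i_2+i_3=n\\ 0\le i_1,i_2,i_3\le n}}\nu_{i_1}\nu_{i_2}\nu_{i_3},\qquad n\ge0.$$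
   Context: $\Omega\subset\mathbb{R}^d$, $d>2$, is a bounded domain with smooth boundary and $k>0$. $G$ is the Green's function: $\Delta_xG(x,y)+k^2G(x,y)=\delta(x-y)$ in $\Omega$, $\partial G/\partial\nu_y=0$ on $\partial\Omega$ (assumed to exist). The background field $u_0=u_0(x,s)$ is real valued, where for each source label $s\in\partial\Omega$ (in the paper, the position of a point source) $u_0(\cdot,s)$ solves $\Delta u_0+k^2u_0=0$ in $\Omega$ with Neumann data $\partial u_0/\partial\nu=g$ given by that source; it is assumed that $u_0\in C(\overline\Omega\times\partial\Omega)$. A multilinear operator of order $l$ is an $l$-linear map $T_l:([L^\infty(\Omega)]^2)^l\to C(\overline\Omega\times\partial\Omega)$; order-zero operators are elements of $C(\overline\Omega\times\partial\Omega)$. Arguments are pairs $\zeta=(\alpha,\beta)$, with norm $\|\zeta\|=\max(\|\alpha\|_\infty,\|\beta\|_\infty)$. For $v\in C(\overline\Omega\times\partial\Omega)$ set $a(v,\zeta)(x,s)=-k^2\int_\Omega G(x,y)\alpha(y)v(y,s)\,dy$ and $b(v,\zeta)(x,s)=-k^2\int_\Omega G(x,y)\beta(y)v(y,s)\,dy$. For $T_l$ of order $l$, define operators of order $l+1$ by $AT_l(\zeta_1,\dots,\zeta_{l+1})=a(T_l(\zeta_1,\dots,\zeta_l),\zeta_{l+1})$ and $BT_l(\zeta_1,\dots,\zeta_{l+1})=b(T_l(\zeta_1,\dots,\zeta_l),\zeta_{l+1})$. The tensor product is the pointwise product $T_l\otimes T_j(\zeta_1,\dots,\zeta_{l+j})=T_l(\zeta_1,\dots,\zeta_l)T_j(\zeta_{l+1},\dots,\zeta_{l+j})$.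 The forward operators are defined by $K_0=u_0$ and, for $n\ge0$, $$K_{n+1}=AK_n+B\sum_{\substack{(i_1,i_2,i_3)\\ i_1+i_2+i_3=n\\ 0\le i_1,i_2,i_3\le n}}K_{i_1}\otimes K_{i_2}\otimes K_{i_3}$$ ($B$ applied to the whole sum), so $K_n$ has order $n$. The bound of a multilinear operator $K$ of order $n$ is $|K|_\infty=\sup_{\zeta_1,\dots,\zeta_n}\frac{\|K(\zeta_1,\dots,\zeta_n)\|}{\|\zeta_1\|\cdots\|\zeta_n\|}$ (sup over nonzero $\zeta_i$, with the sup norm in the numerator).
   Formalization: The Green's function G is additionally assumed continuous off the diagonal on the closure of Ω and bounded by C|x−y|^(2−d), as classical Neumann Green's functions are; the displayed conditions alone allow adding an unbounded Helmholtz solution h(x), for which the claim fails. *)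

theory Defs
  imports "HOL-Analysis.Analysis" "HOL-Probability.Essential_Supremum"
begin

section \<open>Smooth functions and smooth bounded domains\<close>

text \<open>Meaningful for open \<open>U\<close>: all iterated directional derivatives up to order \<open>n\<close> exist
  and are continuous on \<open>U\<close>.\<close>

primrec Ck_on :: "nat \<Rightarrow> 'a::euclidean_space set \<Rightarrow> ('a \<Rightarrow> real) \<Rightarrow> bool" where
  "Ck_on 0 U f \<longleftrightarrow> continuous_on U f"
| "Ck_on (Suc n) U f \<longleftrightarrow>
     (\<forall>x\<in>U. f differentiable (at x)) \<and> (\<forall>v. Ck_on n U (\<lambda>x. frechet_derivative f (at x) v))"

definition smooth_on :: "'a::euclidean_space set \<Rightarrow> ('a \<Rightarrow> real) \<Rightarrow> bool" where
  "smooth_on U f \<longleftrightarrow> (\<forall>n. Ck_on n U f)"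

definition laplacian :: "('a::euclidean_space \<Rightarrow> real) \<Rightarrow> 'a \<Rightarrow> real" where
  "laplacian f x =
     (\<Sum>b\<in>Basis. frechet_derivative (\<lambda>z. frechet_derivative f (at z) b) (at x) b)"

definition local_defining_function ::
    "'a::euclidean_space set \<Rightarrow> 'a set \<Rightarrow> ('a \<Rightarrow> real) \<Rightarrow> bool" where
  "local_defining_function \<Omega> U \<rho> \<longleftrightarrow>
     open U \<and> smooth_on U \<rho> \<and> (\<forall>x\<in>U. \<exists>D. GDERIV \<rho> x :> D \<and> D \<noteq> 0) \<and>
     \<Omega> \<inter> U = {x \<in> U. \<rho> x < 0}"

definition smooth_bounded_domain :: "'a::euclidean_space set \<Rightarrow> bool" where
  "smooth_bounded_domain \<Omega> \<longleftrightarrow>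
     open \<Omega> \<and> connected \<Omega> \<and> bounded \<Omega> \<and> \<Omega> \<noteq> {} \<and>
     (\<forall>p\<in>frontier \<Omega>. \<exists>U \<rho>. p \<in> U \<and> local_defining_function \<Omega> U \<rho>)"

definition outward_unit_normal :: "'a::euclidean_space set \<Rightarrow> 'a \<Rightarrow> 'a \<Rightarrow> bool" where
  "outward_unit_normal \<Omega> p \<nu> \<longleftrightarrow>
     (\<exists>U \<rho> D. p \<in> U \<and> local_defining_function \<Omega> U \<rho> \<and> GDERIV \<rho> p :> D \<and> \<nu> = D /\<^sub>R norm D)"

text \<open>The one-sided derivative, from inside \<open>\<Omega>\<close>, of \<open>f\<close> at \<open>p\<close> along the outward
  unit normal; only values of \<open>f\<close> on the closure of \<open>\<Omega>\<close> matter.\<close>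

definition has_normal_derivative ::
    "'a::euclidean_space set \<Rightarrow> ('a \<Rightarrow> real) \<Rightarrow> 'a \<Rightarrow> real \<Rightarrow> bool" where
  "has_normal_derivative \<Omega> f p D \<longleftrightarrow>
     (\<forall>\<nu>. outward_unit_normal \<Omega> p \<nu> \<longrightarrow>
        ((\<lambda>t. (f p - f (p - t *\<^sub>R \<nu>)) / t) \<longlongrightarrow> D) (at_right 0))"

section \<open>The Green's function and the background field\<close>

definition test_function :: "'a::euclidean_space set \<Rightarrow> ('a \<Rightarrow> real) \<Rightarrow> bool" where
  "test_function \<Omega> \<phi> \<longleftrightarrow>
     smooth_on UNIV \<phi> \<and> compact (closure {x. \<phi> x \<noteq> 0}) \<and> closure {x. \<phi> x \<noteq> 0} \<subseteq> \<Omega>"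

text \<open>The first conjunct is \<open>\<Delta>\<^sub>x G(x,y) + k\<^sup>2 G(x,y) = \<delta>(x - y)\<close> in the sense of
  distributions.\<close>

definition neumann_green_function ::
    "'a::euclidean_space set \<Rightarrow> real \<Rightarrow> ('a \<Rightarrow> 'a \<Rightarrow> real) \<Rightarrow> bool" where
  "neumann_green_function \<Omega> k G \<longleftrightarrow>
     (\<forall>y\<in>\<Omega>. \<forall>\<phi>. test_function \<Omega> \<phi> \<longrightarrow>
        has_bochner_integral (lebesgue_on \<Omega>) (\<lambda>x. G x y * (laplacian \<phi> x + k\<^sup>2 * \<phi> x)) (\<phi> y)) \<and>
     (\<forall>x\<in>\<Omega>. \<forall>y\<in>frontier \<Omega>. has_normal_derivative \<Omega> (G x) y 0)"

text \<open>The classical regularity of a Green's function of a second-order elliptic operator in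
  dimension \<open>d > 2\<close>, up to a smooth boundary. It does not follow from
  \<open>neumann_green_function\<close>: with the equation imposed in \<open>x\<close> and the boundary
  condition in \<open>y\<close>, any \<open>h(x)\<close> with \<open>\<Delta>h + k\<^sup>2 h = 0\<close>
  in \<open>\<Omega>\<close>, even if unbounded near the boundary, may be added to \<open>G(x,y)\<close>.
  The values of \<open>G\<close> on the diagonal are irrelevant.\<close>

definition green_singularity :: "'a::euclidean_space set \<Rightarrow> ('a \<Rightarrow> 'a \<Rightarrow> real) \<Rightarrow> bool" where
  "green_singularity \<Omega> G \<longleftrightarrow>
     continuous_on {(x, y). x \<in> closure \<Omega> \<and> y \<in> closure \<Omega> \<and> x \<noteq> y} (\<lambda>(x, y). G x y) \<and>
     (\<exists>C. \<forall>x\<in>closure \<Omega>. \<forall>y\<in>closure \<Omega>. x \<noteq> y \<longrightarrow>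
        \<bar>G x y\<bar> \<le> C / norm (x - y) ^ (DIM('a) - 2))"

definition background_solution ::
    "'a::euclidean_space set \<Rightarrow> real \<Rightarrow> ('a \<Rightarrow> real) \<Rightarrow> ('a \<Rightarrow> real) \<Rightarrow> bool" where
  "background_solution \<Omega> k g u \<longleftrightarrow>
     Ck_on 2 \<Omega> u \<and> (\<forall>x\<in>\<Omega>. laplacian u x + k\<^sup>2 * u x = 0) \<and>
     (\<forall>x\<in>frontier \<Omega>. has_normal_derivative \<Omega> u x (g x))"

section \<open>Function spaces\<close>

text \<open>Elements of \<open>L\<^sup>\<infinity>(\<Omega>)\<close> are represented by functions, elements of
  \<open>C(closure \<Omega> \<times> \<partial>\<Omega>)\<close> by functions of which only the values on that set matter.\<close>

definition Linf :: "'a::euclidean_space set \<Rightarrow> ('a \<Rightarrow> real) set" where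
  "Linf \<Omega> = {\<alpha> \<in> borel_measurable (lebesgue_on \<Omega>).
              esssup (lebesgue_on \<Omega>) (\<lambda>x. ereal \<bar>\<alpha> x\<bar>) < \<infinity>}"

definition Linf_norm :: "'a::euclidean_space set \<Rightarrow> ('a \<Rightarrow> real) \<Rightarrow> real" where
  "Linf_norm \<Omega> \<alpha> = real_of_ereal (esssup (lebesgue_on \<Omega>) (\<lambda>x. ereal \<bar>\<alpha> x\<bar>))"

type_synonym 'a coeff = "('a \<Rightarrow> real) \<times> ('a \<Rightarrow> real)"

definition coeff_norm :: "'a::euclidean_space set \<Rightarrow> 'a coeff \<Rightarrow> real" where
  "coeff_norm \<Omega> \<zeta> = max (Linf_norm \<Omega> (fst \<zeta>)) (Linf_norm \<Omega> (snd \<zeta>))"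

definition coeff_lincomb :: "real \<Rightarrow> 'a coeff \<Rightarrow> real \<Rightarrow> 'a coeff \<Rightarrow> 'a coeff" where
  "coeff_lincomb c \<zeta> d \<xi> =
     (\<lambda>x. c * fst \<zeta> x + d * fst \<xi> x, \<lambda>x. c * snd \<zeta> x + d * snd \<xi> x)"

definition C_norm :: "'a::euclidean_space set \<Rightarrow> ('a \<times> 'a \<Rightarrow> real) \<Rightarrow> real" where
  "C_norm \<Omega> v = (SUP p\<in>closure \<Omega> \<times> frontier \<Omega>. \<bar>v p\<bar>)"

section \<open>Multilinear operators\<close>

text \<open>An operator of order \<open>l\<close> takes the list of its \<open>l\<close> arguments.\<close>

type_synonym 'a oper = "'a coeff list \<Rightarrow> 'a \<times> 'a \<Rightarrow> real"

definition coeff_tuples :: "'a::euclidean_space set \<Rightarrow> nat \<Rightarrow> 'a coeff list set" where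
  "coeff_tuples \<Omega> l = {zs. length zs = l \<and> set zs \<subseteq> Linf \<Omega> \<times> Linf \<Omega>}"

text \<open>The second conjunct makes the operator well defined on almost-everywhere classes.\<close>

definition multilinear_oper :: "'a::euclidean_space set \<Rightarrow> nat \<Rightarrow> 'a oper \<Rightarrow> bool" where
  "multilinear_oper \<Omega> l T \<longleftrightarrow>
     (\<forall>zs\<in>coeff_tuples \<Omega> l. continuous_on (closure \<Omega> \<times> frontier \<Omega>) (T zs)) \<and>
     (\<forall>zs\<in>coeff_tuples \<Omega> l. \<forall>ws\<in>coeff_tuples \<Omega> l.
        (\<forall>i<l. AE x in lebesgue_on \<Omega>. fst (zs ! i) x = fst (ws ! i) x
                                      \<and> snd (zs ! i) x = snd (ws ! i) x) \<longrightarrow>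
        (\<forall>p\<in>closure \<Omega> \<times> frontier \<Omega>. T zs p = T ws p)) \<and>
     (\<forall>zs\<in>coeff_tuples \<Omega> l. \<forall>i<l. \<forall>\<zeta>\<in>Linf \<Omega> \<times> Linf \<Omega>. \<forall>\<xi>\<in>Linf \<Omega> \<times> Linf \<Omega>. \<forall>c d.
        \<forall>p\<in>closure \<Omega> \<times> frontier \<Omega>.
          T (zs[i := coeff_lincomb c \<zeta> d \<xi>]) p = c * T (zs[i := \<zeta>]) p + d * T (zs[i := \<xi>]) p)"

definition oper_bound :: "'a::euclidean_space set \<Rightarrow> nat \<Rightarrow> 'a oper \<Rightarrow> ereal" where
  "oper_bound \<Omega> l T =
     (SUP zs\<in>{zs \<in> coeff_tuples \<Omega> l. \<forall>\<zeta>\<in>set zs. coeff_norm \<Omega> \<zeta> \<noteq> 0}.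
        ereal (C_norm \<Omega> (T zs) / (\<Prod>\<zeta>\<leftarrow>zs. coeff_norm \<Omega> \<zeta>)))"

definition bounded_multilinear_oper :: "'a::euclidean_space set \<Rightarrow> nat \<Rightarrow> 'a oper \<Rightarrow> bool" where
  "bounded_multilinear_oper \<Omega> l T \<longleftrightarrow> multilinear_oper \<Omega> l T \<and> oper_bound \<Omega> l T < \<infinity>"

section \<open>The forward operators\<close>

definition op_a :: "'a::euclidean_space set \<Rightarrow> real \<Rightarrow> ('a \<Rightarrow> 'a \<Rightarrow> real) \<Rightarrow>
    ('a \<times> 'a \<Rightarrow> real) \<Rightarrow> 'a coeff \<Rightarrow> 'a \<times> 'a \<Rightarrow> real" where
  "op_a \<Omega> k G v \<zeta> = (\<lambda>(x, s). - k\<^sup>2 * (LINT y|lebesgue_on \<Omega>. G x y * fst \<zeta> y * v (y, s)))"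

definition op_b :: "'a::euclidean_space set \<Rightarrow> real \<Rightarrow> ('a \<Rightarrow> 'a \<Rightarrow> real) \<Rightarrow>
    ('a \<times> 'a \<Rightarrow> real) \<Rightarrow> 'a coeff \<Rightarrow> 'a \<times> 'a \<Rightarrow> real" where
  "op_b \<Omega> k G v \<zeta> = (\<lambda>(x, s). - k\<^sup>2 * (LINT y|lebesgue_on \<Omega>. G x y * snd \<zeta> y * v (y, s)))"

definition op_A :: "'a::euclidean_space set \<Rightarrow> real \<Rightarrow> ('a \<Rightarrow> 'a \<Rightarrow> real) \<Rightarrow> 'a oper \<Rightarrow> 'a oper" where
  "op_A \<Omega> k G T zs = op_a \<Omega> k G (T (butlast zs)) (last zs)"

definition op_B :: "'a::euclidean_space set \<Rightarrow> real \<Rightarrow> ('a \<Rightarrow> 'a \<Rightarrow> real) \<Rightarrow> 'a oper \<Rightarrow> 'a oper" where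
  "op_B \<Omega> k G T zs = op_b \<Omega> k G (T (butlast zs)) (last zs)"

text \<open>The parameter \<open>l\<close> is the order of the left factor.\<close>

definition oper_tensor :: "nat \<Rightarrow> 'a oper \<Rightarrow> 'a oper \<Rightarrow> 'a oper" where
  "oper_tensor l T S = (\<lambda>zs p. T (take l zs) p * S (drop l zs) p)"

fun forward_oper :: "'a::euclidean_space set \<Rightarrow> real \<Rightarrow> ('a \<Rightarrow> 'a \<Rightarrow> real) \<Rightarrow>
    ('a \<times> 'a \<Rightarrow> real) \<Rightarrow> nat \<Rightarrow> 'a oper" where
  "forward_oper \<Omega> k G u\<^sub>0 0 = (\<lambda>zs. u\<^sub>0)"
| "forward_oper \<Omega> k G u\<^sub>0 (Suc n) = (\<lambda>zs p.
     op_A \<Omega> k G (forward_oper \<Omega> k G u\<^sub>0 n) zs p +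
     op_B \<Omega> k G (\<lambda>ws q. \<Sum>(i\<^sub>1, i\<^sub>2, i\<^sub>3)\<in>{(i\<^sub>1, i\<^sub>2, i\<^sub>3). i\<^sub>1 + i\<^sub>2 + i\<^sub>3 = n}.
       oper_tensor (i\<^sub>1 + i\<^sub>2)
         (oper_tensor i\<^sub>1 (forward_oper \<Omega> k G u\<^sub>0 i\<^sub>1) (forward_oper \<Omega> k G u\<^sub>0 i\<^sub>2))
         (forward_oper \<Omega> k G u\<^sub>0 i\<^sub>3) ws q) zs p)"

fun nu_seq :: "real \<Rightarrow> nat \<Rightarrow> real" where
  "nu_seq \<nu>\<^sub>0 0 = \<nu>\<^sub>0"
| "nu_seq \<nu>\<^sub>0 (Suc n) = nu_seq \<nu>\<^sub>0 n +
     (\<Sum>(i\<^sub>1, i\<^sub>2, i\<^sub>3)\<in>{(i\<^sub>1, i\<^sub>2, i\<^sub>3). i\<^sub>1 + i\<^sub>2 + i\<^sub>3 = n}. nu_seq \<nu>\<^sub>0 i\<^sub>1 * nu_seq \<nu>\<^sub>0 i\<^sub>2 * nu_seq \<nu>\<^sub>0 i\<^sub>3)"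

definition green_mu :: "'a::euclidean_space set \<Rightarrow> real \<Rightarrow> ('a \<Rightarrow> 'a \<Rightarrow> real) \<Rightarrow> real" where
  "green_mu \<Omega> k G = k\<^sup>2 * (SUP x\<in>\<Omega>. LINT y|lebesgue_on \<Omega>. \<bar>G x y\<bar>)"

end

theory Submission
  imports Defs
begin

text \<open>Since \<open>\<bar>G x y\<bar>\<close> is at most a multiple of \<open>norm (x - y) ^ (2 - d)\<close>, the mass it carries on a
  ball of radius \<open>r\<close> is of order \<open>r\<^sup>2\<close> uniformly in the centre. Hence the integral operators with
  kernel \<open>G\<close> map bounded densities to continuous functions, with operator norm at most
  \<open>\<mu> / k\<^sup>2\<close> even at boundary points. Each application of \<open>A\<close> or \<open>B\<close> therefore costs a factor
  \<open>\<mu>\<close>, and the recursions for \<open>K\<^sub>n\<close> and \<open>\<nu>\<^sub>n\<close> match term by term, which gives the bound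
  \<open>\<nu>\<^sub>n * \<mu> ^ n\<close>. The sequence \<open>\<nu>\<^sub>n\<close> grows at most exponentially because the partial sums of its
  generating function stay bounded at a small positive point.\<close>

section \<open>The majorant sequence\<close>

lemma finite_triples: "finite {(i\<^sub>1, i\<^sub>2, i\<^sub>3). i\<^sub>1 + i\<^sub>2 + i\<^sub>3 = (n::nat)}"
  by (rule finite_subset[of _ "{..n} \<times> {..n} \<times> {..n}"]) auto

lemma nu_seq_nonneg:
  assumes "0 \<le> \<nu>\<^sub>0"
  shows "0 \<le> nu_seq \<nu>\<^sub>0 n"
proof (induction n rule: less_induct)
  case (less n)
  show ?case
  proof (cases n)
    case (Suc m)
    then have "0 \<le> nu_seq \<nu>\<^sub>0 i" if "i \<le> m" for i
      using less that by simp
    then show ?thesis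
      using Suc by (auto intro!: add_nonneg_nonneg sum_nonneg mult_nonneg_nonneg)
  qed (use assms in simp)
qed

text \<open>The cubic recursion bounds the partial sums of the generating function at \<open>r\<close> in terms
  of the preceding ones by \<open>\<nu>\<^sub>0 + r * (S + S\<^sup>3)\<close>, which keeps them below \<open>\<nu>\<^sub>0 + 1\<close> for small \<open>r\<close>.\<close>

lemma nu_seq_partial_sums:
  assumes "0 \<le> \<nu>\<^sub>0" "0 \<le> r" and r: "r * ((\<nu>\<^sub>0 + 1) + (\<nu>\<^sub>0 + 1) ^ 3) \<le> 1"
  shows "(\<Sum>n\<le>N. nu_seq \<nu>\<^sub>0 n * r ^ n) \<le> \<nu>\<^sub>0 + 1"
proof (induction N)
  case (Suc N)
  define a where "a n = nu_seq \<nu>\<^sub>0 n * r ^ n" for n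
  define S where "S = (\<Sum>n\<le>N. a n)"
  define I where "I n = {(i\<^sub>1, i\<^sub>2, i\<^sub>3). i\<^sub>1 + i\<^sub>2 + i\<^sub>3 = (n::nat)}" for n
  have a: "0 \<le> a n" for n
    using assms nu_seq_nonneg by (simp add: a_def)
  \<comment> \<open>Weighting the recursion by powers of \<open>r\<close> keeps its shape: on
    \<open>I n\<close> the indices add up to \<open>n\<close>, so \<open>r ^ n\<close> splits into
    one factor for each of the three terms.\<close>
  have rec: "a (Suc n) = r * (a n + (\<Sum>(i, j, l)\<in>I n. a i * a j * a l))" for n
  proof -
    have "(\<Sum>(i, j, l)\<in>I n. a i * a j * a l) =
        (\<Sum>(i, j, l)\<in>I n. nu_seq \<nu>\<^sub>0 i * nu_seq \<nu>\<^sub>0 j * nu_seq \<nu>\<^sub>0 l) * r ^ n"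
      unfolding sum_distrib_right
      by (rule sum.cong) (auto simp: a_def I_def power_add)
    then show ?thesis
      by (simp add: a_def I_def algebra_simps)
  qed
  \<comment> \<open>The triples with sum at most \<open>N\<close> form a disjoint union inside a
    cube of indices. All terms are nonnegative, so passing to the cube only adds to the sum, which
    then factors.\<close>
  have "(\<Sum>n\<le>N. \<Sum>(i, j, l)\<in>I n. a i * a j * a l) =
      (\<Sum>(i, j, l)\<in>(\<Union>n\<le>N. I n). a i * a j * a l)"
    by (subst sum.UNION_disjoint) (use finite_triples in \<open>auto simp: I_def\<close>)
  also have "\<dots> \<le> (\<Sum>(i, j, l)\<in>{..N} \<times> {..N} \<times> {..N}. a i * a j * a l)"
    by (rule sum_mono2) (auto simp: I_def intro!: mult_nonneg_nonneg a)
  also have "\<dots> = S ^ 3"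
    by (simp add: S_def sum.cartesian_product[symmetric] sum_distrib_left[symmetric]
        sum_distrib_right[symmetric] power3_eq_cube mult.assoc)
  finally have cub: "(\<Sum>n\<le>N. \<Sum>(i, j, l)\<in>I n. a i * a j * a l) \<le> S ^ 3" .
  have S: "0 \<le> S" "S \<le> \<nu>\<^sub>0 + 1"
    using Suc a by (auto simp: S_def a_def intro: sum_nonneg)
  have "(\<Sum>n\<le>Suc N. a n) = a 0 + (\<Sum>n\<le>N. a (Suc n))"
    by (rule sum.atMost_Suc_shift)
  also have "\<dots> = \<nu>\<^sub>0 + r * (S + (\<Sum>n\<le>N. \<Sum>(i, j, l)\<in>I n. a i * a j * a l))"
    unfolding rec by (simp add: sum_distrib_left[symmetric] sum.distrib S_def) (simp add: a_def)
  also have "\<dots> \<le> \<nu>\<^sub>0 + r * ((\<nu>\<^sub>0 + 1) + (\<nu>\<^sub>0 + 1) ^ 3)"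
    using cub S power_mono[OF S(2) S(1), of 3] assms(2)
    by (intro add_left_mono mult_left_mono) linarith+
  also have "\<dots> \<le> \<nu>\<^sub>0 + 1"
    using r by simp
  finally show ?case
    by (simp add: a_def)
qed simp

lemma nu_seq_exponential_bound:
  assumes "0 \<le> \<nu>\<^sub>0"
  shows "nu_seq \<nu>\<^sub>0 n \<le> (\<nu>\<^sub>0 + 1) * ((\<nu>\<^sub>0 + 1) + (\<nu>\<^sub>0 + 1) ^ 3) ^ n"
proof -
  define K where "K = (\<nu>\<^sub>0 + 1) + (\<nu>\<^sub>0 + 1) ^ 3"
  have K: "0 < K"
    using assms by (simp add: K_def add_pos_pos)
  have "nu_seq \<nu>\<^sub>0 n * (1 / K) ^ n \<le> (\<Sum>m\<le>n. nu_seq \<nu>\<^sub>0 m * (1 / K) ^ m)"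
    using K by (intro member_le_sum) (auto simp: nu_seq_nonneg assms)
  also have "\<dots> \<le> \<nu>\<^sub>0 + 1"
    by (rule nu_seq_partial_sums) (use assms K in \<open>auto simp: K_def\<close>)
  finally have "nu_seq \<nu>\<^sub>0 n \<le> (\<nu>\<^sub>0 + 1) * K ^ n"
    using K by (simp add: field_simps)
  then show ?thesis
    by (simp only: K_def)
qed

section \<open>Potentials of a weakly singular kernel\<close>

text \<open>Dyadic shells around \<open>x\<close>: on \<open>r / 2 ^ Suc n \<le> norm (x - y) < r / 2 ^ n\<close> the kernel is
  at most \<open>(2 ^ Suc n / r) ^ p\<close>.\<close>

lemma nn_integral_ball_kernel:
  fixes x :: "'a::euclidean_space"
  assumes p: "p + 2 = DIM('a)" "0 < p" and r: "0 < r"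
  shows "(\<integral>\<^sup>+y. ennreal (indicator (ball x r) y / norm (x - y) ^ p) \<partial>lborel)
    \<le> ennreal (unit_ball_vol (DIM('a)) * 2 ^ p * (4/3) * r\<^sup>2)"
proof -
  \<comment> \<open>Each shell is enlarged to the full ball of its outer radius. The overlap costs
    only a constant factor, and the measures become explicit.\<close>
  define h where "h n y = ennreal ((2 ^ Suc n / r) ^ p) * indicator (ball x (r / 2 ^ n)) y" for n y
  have "ennreal (indicator (ball x r) y / norm (x - y) ^ p) \<le> (\<Sum>n. h n y)" for y
  proof (cases "y \<in> ball x r \<and> x \<noteq> y")
    case True
    \<comment> \<open>The least such index picks the shell containing \<open>y\<close>: minimality
      yields the outer radius, except for index 0, where membership in the ball does.\<close>
    define n where "n = (LEAST n. r / 2 ^ Suc n \<le> norm (x - y))"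
    have "(\<lambda>n. r / 2 ^ n) \<longlonglongrightarrow> 0"
      by (rule LIMSEQ_divide_realpow_zero) simp
    then have "(\<lambda>n. r / 2 ^ Suc n) \<longlonglongrightarrow> 0"
      by (rule LIMSEQ_Suc)
    then have "\<forall>\<^sub>F n in sequentially. r / 2 ^ Suc n < norm (x - y)"
      by (rule order_tendstoD) (use True in simp)
    then obtain n0 where "r / 2 ^ Suc n0 < norm (x - y)"
      unfolding eventually_sequentially by blast
    then have n: "r / 2 ^ Suc n \<le> norm (x - y)"
      unfolding n_def by (metis LeastI less_imp_le)
    have n': "norm (x - y) < r / 2 ^ n"
    proof (cases n)
      case 0
      then show ?thesis
        using True by (simp add: dist_norm)
    next
      case (Suc m)
      then have "m < n"
        by simp
      then have "\<not> r / 2 ^ Suc m \<le> norm (x - y)"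
        unfolding n_def by (rule not_less_Least)
      then show ?thesis
        by (simp only: Suc not_le)
    qed
    have "1 / norm (x - y) \<le> 2 ^ Suc n / r"
      using n r True by (simp add: field_simps)
    then have "(1 / norm (x - y)) ^ p \<le> (2 ^ Suc n / r) ^ p"
      by (intro power_mono) auto
    then have "ennreal (indicator (ball x r) y / norm (x - y) ^ p) \<le> h n y"
      using True n' by (auto simp: h_def power_divide dist_norm intro!: ennreal_leI)
    also have "\<dots> \<le> (\<Sum>n. h n y)"
      using sum_le_suminf[of "\<lambda>n. h n y" "{n}"] by simp
    finally show ?thesis .
  next
    \<comment> \<open>Off the ball the indicator vanishes. At \<open>y = x\<close> the quotient has
      the default value 0 of a division by zero, since \<open>0 < p\<close> makes the power
      vanish.\<close>
    case False
    then show ?thesis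
      using p(2) by (auto simp: zero_power)
  qed
  then have "(\<integral>\<^sup>+y. ennreal (indicator (ball x r) y / norm (x - y) ^ p) \<partial>lborel)
      \<le> (\<integral>\<^sup>+y. (\<Sum>n. h n y) \<partial>lborel)"
    by (intro nn_integral_mono)
  also have "\<dots> = (\<Sum>n. \<integral>\<^sup>+y. h n y \<partial>lborel)"
    unfolding h_def by (rule nn_integral_suminf) (intro borel_measurable_times_ennreal borel_measurable_indicator, simp_all)
  also have "\<dots> = (\<Sum>n. ennreal (unit_ball_vol (DIM('a)) * 2 ^ p * r\<^sup>2 * (1/4) ^ n))"
  proof (rule suminf_cong)
    fix n
    have "(\<integral>\<^sup>+y. h n y \<partial>lborel) = ennreal ((2 ^ Suc n / r) ^ p) * emeasure lborel (ball x (r / 2 ^ n))"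
      unfolding h_def by (rule nn_integral_cmult_indicator) simp
    also have "\<dots> = ennreal ((2 ^ Suc n / r) ^ p * (unit_ball_vol (DIM('a)) * (r / 2 ^ n) ^ DIM('a)))"
      using r by (simp add: emeasure_ball ennreal_mult)
    \<comment> \<open>All but two powers of the radius cancel against the kernel, up to
      \<open>2 ^ p\<close>. The remaining two leave a geometric series of ratio 1/4, whence the
      factor 4/3.\<close>
    also have "(2 ^ Suc n / r) ^ p * (unit_ball_vol (DIM('a)) * (r / 2 ^ n) ^ DIM('a)) =
        unit_ball_vol (DIM('a)) * 2 ^ p * r\<^sup>2 * (1/4) ^ n"
    proof -
      have "(2 ^ Suc n / r) ^ p * (r / 2 ^ n) ^ p = 2 ^ p"
        using r by (simp add: power_mult_distrib[symmetric])
      moreover have "(r / 2 ^ n) ^ 2 = r\<^sup>2 * (1/4) ^ n"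
        by (simp add: power_divide power_mult[symmetric] mult.commute[of n 2] power_mult)
      ultimately show ?thesis
        unfolding p(1)[symmetric] power_add by (simp add: mult_ac)
    qed
    finally show "(\<integral>\<^sup>+y. h n y \<partial>lborel) = ennreal (unit_ball_vol (DIM('a)) * 2 ^ p * r\<^sup>2 * (1/4) ^ n)" .
  qed
  also have "\<dots> = ennreal (unit_ball_vol (DIM('a)) * 2 ^ p * r\<^sup>2 * (4/3))"
    by (rule suminf_ennreal_eq)
       (use sums_mult[OF geometric_sums[of "1/4::real"], of "unit_ball_vol (DIM('a)) * 2 ^ p * r\<^sup>2"]
         in auto)
  finally show ?thesis
    by (simp add: mult_ac)
qed

section \<open>Essential supremum norms\<close>

lemma Linf_AE_le:
  assumes "\<alpha> \<in> Linf \<Omega>"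
  shows "AE x in lebesgue_on \<Omega>. \<bar>\<alpha> x\<bar> \<le> Linf_norm \<Omega> \<alpha>"
proof -
  define e where "e = esssup (lebesgue_on \<Omega>) (\<lambda>x. ereal \<bar>\<alpha> x\<bar>)"
  have "AE x in lebesgue_on \<Omega>. ereal \<bar>\<alpha> x\<bar> \<le> e"
    unfolding e_def by (rule esssup_AE)
  \<comment> \<open>Membership excludes the value infinity, which \<open>real_of_ereal\<close> would
    send to 0. If \<open>e\<close> is minus infinity, the preceding inequality fails at every point,
    so the claim is vacuous.\<close>
  moreover have "e < \<infinity>"
    using assms by (simp add: Linf_def e_def)
  ultimately show ?thesis
    unfolding Linf_norm_def e_def[symmetric] by (cases e) auto
qed

text \<open>The degenerate essential suprema are infinity, for a non-measurable function, and minus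
  infinity, on a null space. Both are sent to 0 by \<open>real_of_ereal\<close>. In all other cases
  monotonicity allows comparison with the function 0.\<close>

lemma Linf_norm_nonneg: "0 \<le> Linf_norm \<Omega> \<alpha>"
proof (cases "(\<lambda>x. ereal \<bar>\<alpha> x\<bar>) \<in> borel_measurable (lebesgue_on \<Omega>) \<and>
    emeasure (lebesgue_on \<Omega>) (space (lebesgue_on \<Omega>)) \<noteq> 0")
  case True
  then have "esssup (lebesgue_on \<Omega>) (\<lambda>x. 0 :: ereal) \<le> esssup (lebesgue_on \<Omega>) (\<lambda>x. ereal \<bar>\<alpha> x\<bar>)"
    by (intro esssup_mono) auto
  then show ?thesis
    using True by (simp add: Linf_norm_def esssup_const real_of_ereal_pos)
next
  case False
  then have "Linf_norm \<Omega> \<alpha> = 0"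
    by (cases "(\<lambda>x. ereal \<bar>\<alpha> x\<bar>) \<in> borel_measurable (lebesgue_on \<Omega>)")
       (simp_all add: Linf_norm_def esssup_zero_space esssup_non_measurable top_ereal_def)
  then show ?thesis
    by simp
qed

lemma const_in_Linf: "(\<lambda>x. c) \<in> Linf \<Omega>"
proof -
  have "esssup (lebesgue_on \<Omega>) (\<lambda>x. ereal \<bar>c\<bar>) \<le> ereal \<bar>c\<bar>"
    by (rule esssup_I) auto
  then show ?thesis
    by (auto simp: Linf_def)
qed

section \<open>Geometry of the domain and regularity of the kernel\<close>

locale green_kernel =
  fixes \<Omega> :: "'a::euclidean_space set" and G :: "'a \<Rightarrow> 'a \<Rightarrow> real"
  assumes dim: "DIM('a) > 2"
    and open_dom: "open \<Omega>"
    and bounded_dom: "bounded \<Omega>"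
    and nonempty_dom: "\<Omega> \<noteq> {}"
    and singularity: "green_singularity \<Omega> G"
begin

lemma dom_sets [measurable, simp]: "\<Omega> \<in> sets lebesgue"
  using open_dom by (simp add: lborelD)

lemma compact_closure_dom: "compact (closure \<Omega>)"
  using bounded_dom by (simp add: compact_closure)

lemma finite_measure_dom: "finite_measure (lebesgue_on \<Omega>)"
  using bounded_dom by (simp add: bounded_set_imp_lmeasurable finite_measure_lebesgue_on)

lemma compact_frontier_dom: "compact (frontier \<Omega>)"
  by (simp add: bounded_dom compact_frontier_bounded)

lemma compact_domain: "compact (closure \<Omega> \<times> frontier \<Omega>)"
  by (intro compact_Times compact_closure_dom compact_frontier_dom)

lemma frontier_nonempty: "frontier \<Omega> \<noteq> {}"
  using bounded_dom nonempty_dom not_bounded_UNIV by (auto simp: frontier_eq_empty)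

lemma dom_subset_closure: "y \<in> \<Omega> \<Longrightarrow> y \<in> closure \<Omega>"
  using closure_subset by blast

lemma singularity_bound:
  obtains C where "0 < C"
    and "\<And>x y. x \<in> closure \<Omega> \<Longrightarrow> y \<in> closure \<Omega> \<Longrightarrow> x \<noteq> y \<Longrightarrow>
      \<bar>G x y\<bar> \<le> C / norm (x - y) ^ (DIM('a) - 2)"
proof -
  obtain C where C: "\<And>x y. x \<in> closure \<Omega> \<Longrightarrow> y \<in> closure \<Omega> \<Longrightarrow> x \<noteq> y \<Longrightarrow>
      \<bar>G x y\<bar> \<le> C / norm (x - y) ^ (DIM('a) - 2)"
    using singularity unfolding green_singularity_def by blast
  show ?thesis
  proof
    fix x y assume *: "x \<in> closure \<Omega>" "y \<in> closure \<Omega>" "x \<noteq> y"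
    show "\<bar>G x y\<bar> \<le> max C 1 / norm (x - y) ^ (DIM('a) - 2)"
      by (rule order.trans[OF C[OF *]]) (intro divide_right_mono, auto)
  qed simp
qed

text \<open>A sequence tending to \<open>x \<noteq> y\<close> eventually avoids \<open>y\<close>, so
  the pairs enter the off-diagonal set on which the kernel is continuous.\<close>

lemma kernel_tendsto:
  assumes "\<And>n. X n \<in> closure \<Omega>" "x \<in> closure \<Omega>" "X \<longlonglongrightarrow> x" "y \<in> \<Omega>" "x \<noteq> y"
  shows "(\<lambda>n. G (X n) y) \<longlonglongrightarrow> G x y"
proof -
  define D where "D = {(x, y). x \<in> closure \<Omega> \<and> y \<in> closure \<Omega> \<and> x \<noteq> y}"
  have c: "continuous_on D (\<lambda>(x, y). G x y)"
    using singularity by (simp add: green_singularity_def D_def)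
  have "\<forall>\<^sub>F n in sequentially. X n \<noteq> y"
    using assms tendsto_imp_eventually_ne by blast
  then have "\<forall>\<^sub>F n in sequentially. (X n, y) \<in> D"
    by eventually_elim (use assms dom_subset_closure in \<open>auto simp: D_def\<close>)
  then have "(\<lambda>n. (\<lambda>(x, y). G x y) (X n, y)) \<longlonglongrightarrow> (\<lambda>(x, y). G x y) (x, y)"
    by (intro continuous_on_tendsto_compose[OF c])
       (use assms dom_subset_closure in \<open>auto simp: D_def intro!: tendsto_intros\<close>)
  then show ?thesis
    by simp
qed

text \<open>The function is continuous away from the single point \<open>x\<close>, and changing a
  value at one point does not affect measurability.\<close>

lemma kernel_measurable [measurable]:
  assumes "x \<in> closure \<Omega>"
  shows "G x \<in> borel_measurable (lebesgue_on \<Omega>)"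
proof -
  have "continuous_on (\<Omega> - {x}) (\<lambda>y. case (x, y) of (x, y) \<Rightarrow> G x y)"
    by (rule continuous_on_compose2[where g = "\<lambda>(x, y). G x y" and f = "\<lambda>y. (x, y)"])
       (use singularity assms dom_subset_closure in
         \<open>auto simp: green_singularity_def intro!: continuous_intros\<close>)
  then have "G x \<in> borel_measurable (lebesgue_on (\<Omega> - {x}))"
    by (intro continuous_imp_measurable_on_sets_lebesgue) auto
  then have "(\<lambda>y. if y \<in> \<Omega> - {x} then G x y else 0) \<in> borel_measurable lebesgue"
    by (subst borel_measurable_if) auto
  then have "(\<lambda>y. if y \<in> \<Omega> - {x} then G x y else 0) \<in> borel_measurable (lebesgue_on \<Omega>)"
    by (rule measurable_restrict_space1)
  then show ?thesis
    by (rule measurable_discrete_difference[where X = "{x} \<inter> \<Omega>"])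
       (auto simp: sets_restrict_space_iff)
qed

lemma continuous_measurable:
  assumes "continuous_on (closure \<Omega>) w"
  shows "w \<in> borel_measurable (lebesgue_on \<Omega>)"
  using continuous_on_subset[OF assms closure_subset] dom_sets
  by (rule continuous_imp_measurable_on_sets_lebesgue)

section \<open>Integrals of the singular kernel\<close>

lemma AE_dom: "AE y in lebesgue_on \<Omega>. y \<in> \<Omega>"
  by (rule AE_I2) simp

lemma AE_neq: "AE y in lebesgue_on \<Omega>. x \<noteq> y"
proof -
  have "AE y in lebesgue. y \<notin> {x}"
    by (rule AE_not_in) simp
  then show ?thesis
    by (subst AE_restrict_space_iff) auto
qed

text \<open>Comparison with a pure power reduces the estimate to
  \<open>nn_integral_ball_kernel\<close>. The constant \<open>C\<close> is returned along with
  \<open>M\<close> because \<open>potential_continuous\<close> builds its truncation level from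
  it.\<close>

lemma kernel_ball_integral:
  obtains C M where "0 < C" "0 < M"
    and "\<And>x y. x \<in> closure \<Omega> \<Longrightarrow> y \<in> closure \<Omega> \<Longrightarrow> x \<noteq> y \<Longrightarrow>
      \<bar>G x y\<bar> \<le> C / norm (x - y) ^ (DIM('a) - 2)"
    and "\<And>x r. x \<in> closure \<Omega> \<Longrightarrow> 0 < r \<Longrightarrow>
      integrable (lebesgue_on \<Omega>) (\<lambda>y. indicator (ball x r) y * \<bar>G x y\<bar>)"
    and "\<And>x r. x \<in> closure \<Omega> \<Longrightarrow> 0 < r \<Longrightarrow>
      (LINT y|lebesgue_on \<Omega>. indicator (ball x r) y * \<bar>G x y\<bar>) \<le> M * r\<^sup>2"
proof -
  obtain C where C: "0 < C" "\<And>x y. x \<in> closure \<Omega> \<Longrightarrow> y \<in> closure \<Omega> \<Longrightarrow> x \<noteq> y \<Longrightarrow>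
      \<bar>G x y\<bar> \<le> C / norm (x - y) ^ (DIM('a) - 2)"
    using singularity_bound by metis
  define p where "p = DIM('a) - 2"
  define M where "M = C * (unit_ball_vol (DIM('a)) * 2 ^ p * (4/3))"
  have p: "p + 2 = DIM('a)" "0 < p"
    using dim by (simp_all add: p_def)
  have M: "0 < M"
    using C by (simp add: M_def)
  have *: "integrable (lebesgue_on \<Omega>) (\<lambda>y. indicator (ball x r) y * \<bar>G x y\<bar>) \<and>
      (LINT y|lebesgue_on \<Omega>. indicator (ball x r) y * \<bar>G x y\<bar>) \<le> M * r\<^sup>2"
    if x: "x \<in> closure \<Omega>" and r: "0 < r" for x r
  proof -
    have [measurable]: "ball x r \<in> sets lebesgue"
      by (simp add: lborelD)
    have m: "(\<lambda>y. indicator (ball x r) y * \<bar>G x y\<bar>) \<in> borel_measurable (lebesgue_on \<Omega>)"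
    proof -
      have "(indicator (ball x r) :: 'a \<Rightarrow> real) \<in> borel_measurable (lebesgue_on \<Omega>)"
        by (intro measurable_restrict_space1 borel_measurable_indicator) fact
      then show ?thesis
        using kernel_measurable[OF x] by measurable
    qed
    have "(\<integral>\<^sup>+y. ennreal (indicator (ball x r) y * \<bar>G x y\<bar>) \<partial>lebesgue_on \<Omega>) \<le>
        (\<integral>\<^sup>+y. ennreal C * ennreal (indicator (ball x r) y / norm (x - y) ^ p) \<partial>lebesgue_on \<Omega>)"
    proof (rule nn_integral_mono_AE)
      show "AE y in lebesgue_on \<Omega>. ennreal (indicator (ball x r) y * \<bar>G x y\<bar>) \<le>
          ennreal C * ennreal (indicator (ball x r) y / norm (x - y) ^ p)"
        using AE_dom AE_neq[of x]
      proof eventually_elim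
        case (elim y)
        have "indicator (ball x r) y * \<bar>G x y\<bar> \<le>
            indicator (ball x r) y * (C / norm (x - y) ^ p)"
          using C(2)[of x y] x elim dom_subset_closure by (intro mult_left_mono) (auto simp: p_def)
        then show ?case
          using C(1) by (simp add: ennreal_mult'[symmetric] ennreal_leI mult.commute)
      qed
    qed
    \<comment> \<open>Integrating over the whole space removes any dependence on how the ball meets
      the boundary, so the constant is uniform in the centre.\<close>
    also have "\<dots> \<le> (\<integral>\<^sup>+y. ennreal C * ennreal (indicator (ball x r) y / norm (x - y) ^ p) \<partial>lebesgue)"
      by (subst nn_integral_restrict_space) (auto intro!: nn_integral_mono simp: indicator_def)
    also have "\<dots> = ennreal C * (\<integral>\<^sup>+y. ennreal (indicator (ball x r) y / norm (x - y) ^ p) \<partial>lborel)"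
    proof -
      have "(\<lambda>y. indicator (ball x r) y / norm (x - y) ^ p :: real) \<in> borel_measurable borel"
        by (intro borel_measurable_divide borel_measurable_indicator borel_measurable_continuous_onI
            continuous_intros) simp
      then show ?thesis
        by (subst nn_integral_completion) (auto intro!: nn_integral_cmult)
    qed
    also have "\<dots> \<le> ennreal C * ennreal (unit_ball_vol (DIM('a)) * 2 ^ p * (4/3) * r\<^sup>2)"
      by (intro mult_left_mono nn_integral_ball_kernel p r) auto
    also have "\<dots> = ennreal (M * r\<^sup>2)"
      using C by (simp add: M_def ennreal_mult'[symmetric] mult_ac)
    finally have le: "(\<integral>\<^sup>+y. ennreal (indicator (ball x r) y * \<bar>G x y\<bar>) \<partial>lebesgue_on \<Omega>) \<le> ennreal (M * r\<^sup>2)" .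
    then have i: "integrable (lebesgue_on \<Omega>) (\<lambda>y. indicator (ball x r) y * \<bar>G x y\<bar>)"
      using m by (intro integrableI_nonneg) (auto simp: le_less_trans)
    then have "ennreal (LINT y|lebesgue_on \<Omega>. indicator (ball x r) y * \<bar>G x y\<bar>) \<le> ennreal (M * r\<^sup>2)"
      using le by (subst nn_integral_eq_integral[symmetric]) auto
    then show ?thesis
      using i M by (simp add: ennreal_le_iff)
  qed
  show ?thesis
    using that[OF C(1) M C(2)] * by blast
qed

text \<open>The domain is bounded, so one ball around \<open>x\<close> contains it and the indicator
  in \<open>kernel_ball_integral\<close> is 1 throughout.\<close>

lemma kernel_integrable:
  assumes "x \<in> closure \<Omega>"
  shows "integrable (lebesgue_on \<Omega>) (\<lambda>y. \<bar>G x y\<bar>)"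
proof -
  obtain R where R: "0 < R" "\<Omega> \<subseteq> ball x R"
    using bounded_dom bounded_subset_ballD by blast
  have "integrable (lebesgue_on \<Omega>) (\<lambda>y. indicator (ball x R) y * \<bar>G x y\<bar>)"
    by (rule kernel_ball_integral) (use assms R in blast)
  then show ?thesis
    by (rule Bochner_Integration.integrable_cong[THEN iffD1, rotated -1]) (use R in \<open>auto simp: indicator_def\<close>)
qed

text \<open>Both parts come from the integrable majorant
  \<open>\<bar>G x y\<bar> * (Linf_norm \<Omega> \<alpha> * B)\<close>, which dominates almost
  everywhere.\<close>

lemma density_integrable:
  assumes x: "x \<in> closure \<Omega>" and \<alpha>: "\<alpha> \<in> Linf \<Omega>" and w: "continuous_on (closure \<Omega>) w"
    and B: "\<And>y. y \<in> closure \<Omega> \<Longrightarrow> \<bar>w y\<bar> \<le> B"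
  shows "integrable (lebesgue_on \<Omega>) (\<lambda>y. G x y * \<alpha> y * w y)"
    and "\<bar>LINT y|lebesgue_on \<Omega>. G x y * \<alpha> y * w y\<bar> \<le>
      (LINT y|lebesgue_on \<Omega>. \<bar>G x y\<bar>) * Linf_norm \<Omega> \<alpha> * B"
proof -
  have [measurable]: "G x \<in> borel_measurable (lebesgue_on \<Omega>)" "\<alpha> \<in> borel_measurable (lebesgue_on \<Omega>)"
    "w \<in> borel_measurable (lebesgue_on \<Omega>)"
    using kernel_measurable[OF x] \<alpha> continuous_measurable[OF w] by (auto simp: Linf_def)
  have i: "integrable (lebesgue_on \<Omega>) (\<lambda>y. \<bar>G x y\<bar> * (Linf_norm \<Omega> \<alpha> * B))"
    using kernel_integrable[OF x] by simp
  have ae: "AE y in lebesgue_on \<Omega>. \<bar>G x y * \<alpha> y * w y\<bar> \<le> \<bar>G x y\<bar> * (Linf_norm \<Omega> \<alpha> * B)"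
    using AE_dom Linf_AE_le[OF \<alpha>]
  proof eventually_elim
    case (elim y)
    then show ?case
      using B[of y] dom_subset_closure Linf_norm_nonneg[of \<Omega> \<alpha>]
      by (auto simp: abs_mult mult.assoc intro!: mult_left_mono mult_mono)
  qed
  show j: "integrable (lebesgue_on \<Omega>) (\<lambda>y. G x y * \<alpha> y * w y)"
    by (rule Bochner_Integration.integrable_bound[OF i]) (use ae in \<open>auto elim: eventually_mono\<close>)
  have "\<bar>LINT y|lebesgue_on \<Omega>. G x y * \<alpha> y * w y\<bar> \<le> (LINT y|lebesgue_on \<Omega>. \<bar>G x y\<bar> * (Linf_norm \<Omega> \<alpha> * B))"
    by (rule order.trans[OF integral_abs_bound integral_mono_AE]) (use i j ae in auto)
  then show "\<bar>LINT y|lebesgue_on \<Omega>. G x y * \<alpha> y * w y\<bar> \<le>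
      (LINT y|lebesgue_on \<Omega>. \<bar>G x y\<bar>) * Linf_norm \<Omega> \<alpha> * B"
    by (simp add: mult.assoc)
qed

text \<open>Truncating the kernel at the level \<open>C / r ^ (d - 2)\<close> changes it only on \<open>ball x r\<close>.
  The potentials of the truncated kernels are continuous by dominated convergence, and they
  converge uniformly as \<open>r\<close> tends to \<open>0\<close>.\<close>

lemma potential_continuous:
  fixes S :: "'b::euclidean_space set"
  assumes \<alpha>: "\<alpha> \<in> Linf \<Omega>" and S: "compact S" and v: "continuous_on (closure \<Omega> \<times> S) v"
  shows "continuous_on (closure \<Omega> \<times> S) (\<lambda>(x, s). LINT y|lebesgue_on \<Omega>. G x y * \<alpha> y * v (y, s))"
    (is "continuous_on ?D ?F")
proof -
  obtain C M where CM: "0 < C" "0 < M"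
    and bnd: "\<And>x y. x \<in> closure \<Omega> \<Longrightarrow> y \<in> closure \<Omega> \<Longrightarrow> x \<noteq> y \<Longrightarrow>
      \<bar>G x y\<bar> \<le> C / norm (x - y) ^ (DIM('a) - 2)"
    and iball: "\<And>x r. x \<in> closure \<Omega> \<Longrightarrow> 0 < r \<Longrightarrow>
      integrable (lebesgue_on \<Omega>) (\<lambda>y. indicator (ball x r) y * \<bar>G x y\<bar>)"
    and ball: "\<And>x r. x \<in> closure \<Omega> \<Longrightarrow> 0 < r \<Longrightarrow>
      (LINT y|lebesgue_on \<Omega>. indicator (ball x r) y * \<bar>G x y\<bar>) \<le> M * r\<^sup>2"
    by (rule kernel_ball_integral) blast
  have "bounded (v ` ?D)"
    by (intro compact_imp_bounded compact_continuous_image v compact_Times compact_closure_dom S)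
  then obtain B where B: "0 < B" "\<And>p. p \<in> ?D \<Longrightarrow> \<bar>v p\<bar> \<le> B"
    by (auto simp: bounded_pos)
  define L where "L = Linf_norm \<Omega> \<alpha>"
  have L: "0 \<le> L"
    by (simp add: L_def Linf_norm_nonneg)
  have [measurable]: "\<alpha> \<in> borel_measurable (lebesgue_on \<Omega>)"
    using \<alpha> by (simp add: Linf_def)
  have vs: "continuous_on (closure \<Omega>) (\<lambda>y. v (y, s))" if "s \<in> S" for s
    by (rule continuous_on_compose2[OF v]) (use that in \<open>auto intro!: continuous_intros\<close>)
  have vm: "(\<lambda>y. v (y, s)) \<in> borel_measurable (lebesgue_on \<Omega>)" if "s \<in> S" for s
    using vs[OF that] by (rule continuous_measurable)
  define lev where "lev r = C / r ^ (DIM('a) - 2)" for r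
  define h where "h r x y = max (- lev r) (min (lev r) (G x y))" for r x y
  define F where "F r = (\<lambda>(x, s). LINT y|lebesgue_on \<Omega>. h r x y * \<alpha> y * v (y, s))" for r
  have hm: "h r x \<in> borel_measurable (lebesgue_on \<Omega>)" if "x \<in> closure \<Omega>" for r x
    using kernel_measurable[OF that] unfolding h_def by measurable
  have lev: "0 < lev r" if "0 < r" for r
    using CM that by (simp add: lev_def)
  have dens: "AE y in lebesgue_on \<Omega>. \<bar>\<alpha> y * v (y, s)\<bar> \<le> L * B" if "s \<in> S" for s
    using AE_dom Linf_AE_le[OF \<alpha>]
  proof eventually_elim
    case (elim y)
    then show ?case
      unfolding abs_mult using that B(2)[of "(y, s)"] L dom_subset_closure
      by (intro mult_mono) (auto simp: L_def)
  qed
  have i_const: "integrable (lebesgue_on \<Omega>) (\<lambda>y. c)" for c :: real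
    by (rule finite_measure.integrable_const[OF finite_measure_dom])
  have hbd: "AE y in lebesgue_on \<Omega>. norm (h r x y * \<alpha> y * v (y, s)) \<le> lev r * (L * B)"
    if "0 < r" "s \<in> S" for r x s
    using dens[OF that(2)]
  proof eventually_elim
    case (elim y)
    have "\<bar>h r x y\<bar> \<le> lev r"
      using lev[OF that(1)] by (auto simp: h_def)
    then show ?case
      using elim lev[OF that(1)] by (simp add: mult.assoc abs_mult mult_mono)
  qed
  have ih: "integrable (lebesgue_on \<Omega>) (\<lambda>y. h r x y * \<alpha> y * v (y, s))"
    if "0 < r" "x \<in> closure \<Omega>" "s \<in> S" for r x s
  proof (rule Bochner_Integration.integrable_bound[OF i_const[of "lev r * (L * B)"]])
    show "(\<lambda>y. h r x y * \<alpha> y * v (y, s)) \<in> borel_measurable (lebesgue_on \<Omega>)"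
      using hm[OF that(2)] vm[OF that(3)] by measurable
    show "AE y in lebesgue_on \<Omega>. norm (h r x y * \<alpha> y * v (y, s)) \<le> norm (lev r * (L * B))"
      using hbd[OF that(1,3), of x] by (rule eventually_mono) simp
  qed
  \<comment> \<open>For fixed \<open>r\<close> the integrands are dominated by one constant,
    integrable because the domain has finite measure. They converge wherever \<alpha> is evaluated
    inside the domain away from the null set \<open>{x}\<close>.\<close>
  have cont: "continuous_on ?D (F r)" if r: "0 < r" for r
  proof (rule continuous_on_sequentiallyI)
    fix u a
    assume u: "\<forall>n. u n \<in> ?D" and a: "a \<in> ?D" and lim: "u \<longlonglongrightarrow> a"
    define X where "X n = fst (u n)" for n
    define s where "s n = snd (u n)" for n
    obtain x t where xt: "a = (x, t)"
      by fastforce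
    have X: "X n \<in> closure \<Omega>" "s n \<in> S" for n
      using u by (auto simp: X_def s_def mem_Times_iff)
    have x: "x \<in> closure \<Omega>" "t \<in> S"
      using a xt by auto
    have lims: "X \<longlonglongrightarrow> x" "s \<longlonglongrightarrow> t"
      using tendsto_fst[OF lim] tendsto_snd[OF lim] by (simp_all add: X_def[abs_def] s_def[abs_def] xt)
    have "(\<lambda>n. LINT y|lebesgue_on \<Omega>. h r (X n) y * \<alpha> y * v (y, s n)) \<longlonglongrightarrow>
        (LINT y|lebesgue_on \<Omega>. h r x y * \<alpha> y * v (y, t))"
    proof (rule integral_dominated_convergence[OF _ _ i_const[of "lev r * (L * B)"]])
      show "(\<lambda>y. h r x y * \<alpha> y * v (y, t)) \<in> borel_measurable (lebesgue_on \<Omega>)"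
        using hm[OF x(1)] vm[OF x(2)] by measurable
      show "(\<lambda>y. h r (X n) y * \<alpha> y * v (y, s n)) \<in> borel_measurable (lebesgue_on \<Omega>)" for n
        using hm[OF X(1)] vm[OF X(2)] by measurable
      show "AE y in lebesgue_on \<Omega>. norm (h r (X n) y * \<alpha> y * v (y, s n)) \<le> lev r * (L * B)" for n
        by (rule hbd[OF r X(2)])
      show "AE y in lebesgue_on \<Omega>.
          (\<lambda>n. h r (X n) y * \<alpha> y * v (y, s n)) \<longlonglongrightarrow> h r x y * \<alpha> y * v (y, t)"
        using AE_dom AE_neq[of x]
      proof eventually_elim
        case (elim y)
        have "(\<lambda>n. v (y, s n)) \<longlonglongrightarrow> v (y, t)"
          by (rule continuous_on_tendsto_compose[OF v])
             (use elim x X lims dom_subset_closure in \<open>auto intro!: tendsto_intros\<close>)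
        moreover have "(\<lambda>n. h r (X n) y) \<longlonglongrightarrow> h r x y"
          unfolding h_def
          by (intro tendsto_max tendsto_min tendsto_const kernel_tendsto) (use elim x X lims in auto)
        ultimately show ?case
          by (intro tendsto_mult tendsto_const)
      qed
    qed
    then show "(\<lambda>n. F r (u n)) \<longlonglongrightarrow> F r a"
      by (simp add: F_def X_def s_def xt case_prod_beta)
  qed
  have approx: "dist (F r q) (?F q) \<le> M * r\<^sup>2 * (L * B)" if r: "0 < r" and q: "q \<in> ?D" for r q
  proof -
    obtain x s where xs: "q = (x, s)" "x \<in> closure \<Omega>" "s \<in> S"
      using q by auto
    have i: "integrable (lebesgue_on \<Omega>) (\<lambda>y. G x y * \<alpha> y * v (y, s))"
      by (rule density_integrable(1)[OF xs(2) \<alpha> vs[OF xs(3)]]) (use B(2) xs in auto)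
    have ib: "integrable (lebesgue_on \<Omega>) (\<lambda>y. indicator (ball x r) y * \<bar>G x y\<bar> * (L * B))"
      using iball[OF xs(2) r] by simp
    have ae: "AE y in lebesgue_on \<Omega>. \<bar>h r x y * \<alpha> y * v (y, s) - G x y * \<alpha> y * v (y, s)\<bar> \<le>
        indicator (ball x r) y * \<bar>G x y\<bar> * (L * B)"
      using AE_dom AE_neq[of x] dens[OF xs(3)]
    proof eventually_elim
      case (elim y)
      \<comment> \<open>Truncation to an interval around 0 moves a value by at most its modulus.
        Outside the ball the singularity bound already keeps the kernel within the level, so nothing
        is cut off.\<close>
      have "\<bar>h r x y - G x y\<bar> \<le> indicator (ball x r) y * \<bar>G x y\<bar>"
      proof (cases "y \<in> ball x r")
        case True
        then show ?thesis
          using lev[OF r] by (auto simp: h_def)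
      next
        case False
        then have "r ^ (DIM('a) - 2) \<le> norm (x - y) ^ (DIM('a) - 2)"
          using r by (intro power_mono) (auto simp: dist_norm)
        then have "C / norm (x - y) ^ (DIM('a) - 2) \<le> lev r"
          unfolding lev_def using r CM by (intro divide_left_mono) (auto intro!: mult_pos_pos simp: elim)
        then have "\<bar>G x y\<bar> \<le> lev r"
          using bnd[of x y] xs elim dom_subset_closure by force
        then show ?thesis
          using False by (auto simp: h_def)
      qed
      moreover have "h r x y * \<alpha> y * v (y, s) - G x y * \<alpha> y * v (y, s) =
          (h r x y - G x y) * (\<alpha> y * v (y, s))"
        by (simp add: algebra_simps)
      ultimately show ?case
        using elim by (simp only: abs_mult[of "h r x y - G x y"]) (auto intro!: mult_mono)
    qed
    have "dist (F r q) (?F q) =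
        \<bar>LINT y|lebesgue_on \<Omega>. h r x y * \<alpha> y * v (y, s) - G x y * \<alpha> y * v (y, s)\<bar>"
      unfolding xs(1) F_def dist_real_def
      using Bochner_Integration.integral_diff[OF ih[OF r xs(2,3)] i] by simp
    also have "\<dots> \<le> (LINT y|lebesgue_on \<Omega>. \<bar>h r x y * \<alpha> y * v (y, s) - G x y * \<alpha> y * v (y, s)\<bar>)"
      by (rule integral_abs_bound)
    also have "\<dots> \<le> (LINT y|lebesgue_on \<Omega>. indicator (ball x r) y * \<bar>G x y\<bar> * (L * B))"
      by (rule integral_mono_AE) (use i ih[OF r xs(2,3)] ib ae in auto)
    also have "\<dots> = (LINT y|lebesgue_on \<Omega>. indicator (ball x r) y * \<bar>G x y\<bar>) * (L * B)"
      by (rule integral_mult_left_zero)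
    also have "\<dots> \<le> M * r\<^sup>2 * (L * B)"
      using ball[OF xs(2) r] L B(1) by (intro mult_right_mono) auto
    finally show ?thesis .
  qed
  have pos: "\<forall>\<^sub>F r in at_right (0::real). 0 < r"
    by (rule eventually_at_right_less)
  have "uniform_limit ?D F ?F (at_right 0)"
  proof (rule uniform_limitI)
    fix e :: real
    assume "0 < e"
    have "((\<lambda>r. M * r\<^sup>2 * (L * B)) \<longlongrightarrow> M * 0\<^sup>2 * (L * B)) (at_right 0)"
      by (intro tendsto_intros)
    then have "\<forall>\<^sub>F r in at_right 0. M * r\<^sup>2 * (L * B) < e"
      by (rule order_tendstoD) (use \<open>0 < e\<close> in simp)
    with pos show "\<forall>\<^sub>F r in at_right 0. \<forall>q\<in>?D. dist (F r q) (?F q) < e"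
      by eventually_elim (use approx in \<open>blast intro: le_less_trans\<close>)
  qed
  moreover have "\<forall>\<^sub>F r in at_right 0. continuous_on ?D (F r)"
    using pos by eventually_elim (rule cont)
  ultimately show ?thesis
    by (intro uniform_limit_theorem[where F = "at_right (0::real)" and f = F]) auto
qed

section \<open>Total mass of the kernel up to the boundary\<close>

lemma green_kernel_abs: "green_kernel \<Omega> (\<lambda>x y. \<bar>G x y\<bar>)"
proof
  have "continuous_on D (\<lambda>q. \<bar>case q of (x, y) \<Rightarrow> G x y\<bar>)"
    if "continuous_on D (\<lambda>(x, y). G x y)" for D
    using that by (rule continuous_on_rabs)
  then show "green_singularity \<Omega> (\<lambda>x y. \<bar>G x y\<bar>)"
    using singularity by (simp add: green_singularity_def case_prod_beta)
qed (use dim open_dom bounded_dom nonempty_dom in auto)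

text \<open>The supremum in \<open>green_mu\<close> runs over the open domain, whereas potentials
  are evaluated on its closure. Continuity of the mass up to the boundary carries the bound
  over.\<close>

lemma kernel_mass_le_green_mu:
  assumes x: "x \<in> closure \<Omega>"
  shows "k\<^sup>2 * (LINT y|lebesgue_on \<Omega>. \<bar>G x y\<bar>) \<le> green_mu \<Omega> k G"
proof -
  interpret abs: green_kernel \<Omega> "\<lambda>x y. \<bar>G x y\<bar>"
    by (rule green_kernel_abs)
  define m where "m x = (LINT y|lebesgue_on \<Omega>. \<bar>G x y\<bar>)" for x
  \<comment> \<open>The mass is a potential of the kernel \<open>\<bar>G x y\<bar>\<close> with
    density 1 and field 1; the one-point parameter set stands in for the sources.\<close>
  have "continuous_on (closure \<Omega> \<times> {0::real})
      (\<lambda>(x, s). LINT y|lebesgue_on \<Omega>. \<bar>G x y\<bar> * 1 * (\<lambda>_. 1) (y, s))"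
    by (rule abs.potential_continuous) (auto simp: const_in_Linf)
  then have "continuous_on (closure \<Omega>) ((\<lambda>(x, s). m x) \<circ> (\<lambda>x. (x, 0::real)))"
    by (intro continuous_on_compose) (auto simp: m_def image_Pair_const intro!: continuous_intros)
  then have m: "continuous_on (closure \<Omega>) m"
    by (simp add: o_def)
  \<comment> \<open>A real-valued supremum is an upper bound only for a set that is bounded above;
    compactness of the closure provides this.\<close>
  have "bdd_above (m ` closure \<Omega>)"
    by (intro bounded_imp_bdd_above compact_imp_bounded compact_continuous_image m compact_closure_dom)
  then have "bdd_above (m ` \<Omega>)"
    by (rule bdd_above_mono) (intro image_mono closure_subset)
  then have "m z \<le> (SUP x\<in>\<Omega>. m x)" if "z \<in> \<Omega>" for z
    using that by (rule cSUP_upper2) simp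
  then have "m x \<le> (SUP x\<in>\<Omega>. m x)"
    using m x by (intro continuous_le_on_closure[of \<Omega> m x]) auto
  then show ?thesis
    by (auto simp: green_mu_def m_def intro: mult_left_mono)
qed

lemma green_mu_nonneg: "0 \<le> green_mu \<Omega> k G"
proof -
  obtain x where "x \<in> closure \<Omega>"
    using nonempty_dom dom_subset_closure by blast
  then show ?thesis
    by (rule order.trans[OF _ kernel_mass_le_green_mu, rotated]) (simp add: integral_nonneg_AE)
qed

end

section \<open>Bounds of multilinear operators\<close>

lemma coeff_norm_nonneg: "0 \<le> coeff_norm \<Omega> \<zeta>"
  by (simp add: coeff_norm_def Linf_norm_nonneg le_max_iff_disj)

lemma coeff_tuples_Suc:
  assumes "zs \<in> coeff_tuples \<Omega> (Suc l)"
  shows "butlast zs \<in> coeff_tuples \<Omega> l" "last zs \<in> Linf \<Omega> \<times> Linf \<Omega>" "length zs = Suc l" "zs \<noteq> []"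
proof -
  show "length zs = Suc l" and ne: "zs \<noteq> []"
    using assms by (auto simp: coeff_tuples_def)
  show "butlast zs \<in> coeff_tuples \<Omega> l"
    using assms by (auto simp: coeff_tuples_def dest: in_set_butlastD)
  show "last zs \<in> Linf \<Omega> \<times> Linf \<Omega>"
    using assms last_in_set[OF ne] unfolding coeff_tuples_def by blast
qed

lemma coeff_tuples_take:
  "zs \<in> coeff_tuples \<Omega> (l + j) \<Longrightarrow> take l zs \<in> coeff_tuples \<Omega> l"
  by (auto simp: coeff_tuples_def dest: in_set_takeD)

lemma coeff_tuples_drop:
  "zs \<in> coeff_tuples \<Omega> (l + j) \<Longrightarrow> drop l zs \<in> coeff_tuples \<Omega> j"
  by (auto simp: coeff_tuples_def dest: in_set_dropD)

lemma coeff_tuples_update: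
  "zs \<in> coeff_tuples \<Omega> l \<Longrightarrow> \<zeta> \<in> Linf \<Omega> \<times> Linf \<Omega> \<Longrightarrow> zs[i := \<zeta>] \<in> coeff_tuples \<Omega> l"
  unfolding coeff_tuples_def using set_update_subset_insert[of zs i \<zeta>] by auto

section \<open>Sums and tensor products of multilinear operators\<close>

lemma multilinear_operI:
  assumes "\<And>zs. zs \<in> coeff_tuples \<Omega> l \<Longrightarrow> continuous_on (closure \<Omega> \<times> frontier \<Omega>) (T zs)"
    and "\<And>zs ws p. zs \<in> coeff_tuples \<Omega> l \<Longrightarrow> ws \<in> coeff_tuples \<Omega> l \<Longrightarrow>
      (\<And>i. i < l \<Longrightarrow> AE x in lebesgue_on \<Omega>.
        fst (zs ! i) x = fst (ws ! i) x \<and> snd (zs ! i) x = snd (ws ! i) x) \<Longrightarrow>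
      p \<in> closure \<Omega> \<times> frontier \<Omega> \<Longrightarrow> T zs p = T ws p"
    and "\<And>zs i \<zeta> \<xi> c d p. zs \<in> coeff_tuples \<Omega> l \<Longrightarrow> i < l \<Longrightarrow>
      \<zeta> \<in> Linf \<Omega> \<times> Linf \<Omega> \<Longrightarrow> \<xi> \<in> Linf \<Omega> \<times> Linf \<Omega> \<Longrightarrow> p \<in> closure \<Omega> \<times> frontier \<Omega> \<Longrightarrow>
      T (zs[i := coeff_lincomb c \<zeta> d \<xi>]) p = c * T (zs[i := \<zeta>]) p + d * T (zs[i := \<xi>]) p"
  shows "multilinear_oper \<Omega> l T"
  unfolding multilinear_oper_def using assms by blast

lemma multilinear_operD:
  assumes "multilinear_oper \<Omega> l T"
  shows "zs \<in> coeff_tuples \<Omega> l \<Longrightarrow> continuous_on (closure \<Omega> \<times> frontier \<Omega>) (T zs)"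
    and "zs \<in> coeff_tuples \<Omega> l \<Longrightarrow> ws \<in> coeff_tuples \<Omega> l \<Longrightarrow>
      (\<And>i. i < l \<Longrightarrow> AE x in lebesgue_on \<Omega>.
        fst (zs ! i) x = fst (ws ! i) x \<and> snd (zs ! i) x = snd (ws ! i) x) \<Longrightarrow>
      p \<in> closure \<Omega> \<times> frontier \<Omega> \<Longrightarrow> T zs p = T ws p"
    and "zs \<in> coeff_tuples \<Omega> l \<Longrightarrow> i < l \<Longrightarrow>
      \<zeta> \<in> Linf \<Omega> \<times> Linf \<Omega> \<Longrightarrow> \<xi> \<in> Linf \<Omega> \<times> Linf \<Omega> \<Longrightarrow> p \<in> closure \<Omega> \<times> frontier \<Omega> \<Longrightarrow>
      T (zs[i := coeff_lincomb c \<zeta> d \<xi>]) p = c * T (zs[i := \<zeta>]) p + d * T (zs[i := \<xi>]) p"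
  using assms unfolding multilinear_oper_def by blast+

lemma multilinear_oper_sum:
  assumes "\<And>i. i \<in> I \<Longrightarrow> multilinear_oper \<Omega> l (T i)"
  shows "multilinear_oper \<Omega> l (\<lambda>zs p. \<Sum>i\<in>I. T i zs p)"
proof (rule multilinear_operI)
  fix zs assume "zs \<in> coeff_tuples \<Omega> l"
  then show "continuous_on (closure \<Omega> \<times> frontier \<Omega>) (\<lambda>p. \<Sum>i\<in>I. T i zs p)"
    by (intro continuous_on_sum multilinear_operD(1)[OF assms, unfolded eta_contract_eq])
next
  fix zs ws p
  assume *: "zs \<in> coeff_tuples \<Omega> l" "ws \<in> coeff_tuples \<Omega> l"
    "\<And>i. i < l \<Longrightarrow> AE x in lebesgue_on \<Omega>.
        fst (zs ! i) x = fst (ws ! i) x \<and> snd (zs ! i) x = snd (ws ! i) x"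
    "p \<in> closure \<Omega> \<times> frontier \<Omega>"
  show "(\<Sum>i\<in>I. T i zs p) = (\<Sum>i\<in>I. T i ws p)"
    by (rule sum.cong) (use multilinear_operD(2)[OF assms *] in auto)
next
  fix zs j \<zeta> \<xi> c d p
  assume *: "zs \<in> coeff_tuples \<Omega> l" "j < l" "\<zeta> \<in> Linf \<Omega> \<times> Linf \<Omega>" "\<xi> \<in> Linf \<Omega> \<times> Linf \<Omega>"
    "p \<in> closure \<Omega> \<times> frontier \<Omega>"
  have "(\<Sum>i\<in>I. T i (zs[j := coeff_lincomb c \<zeta> d \<xi>]) p) =
      (\<Sum>i\<in>I. c * T i (zs[j := \<zeta>]) p + d * T i (zs[j := \<xi>]) p)"
    by (rule sum.cong) (use multilinear_operD(3)[OF assms *] in auto)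
  then show "(\<Sum>i\<in>I. T i (zs[j := coeff_lincomb c \<zeta> d \<xi>]) p) =
      c * (\<Sum>i\<in>I. T i (zs[j := \<zeta>]) p) + d * (\<Sum>i\<in>I. T i (zs[j := \<xi>]) p)"
    by (simp add: sum.distrib sum_distrib_left)
qed

lemma multilinear_oper_add:
  assumes "multilinear_oper \<Omega> l T" "multilinear_oper \<Omega> l S"
  shows "multilinear_oper \<Omega> l (\<lambda>zs p. T zs p + S zs p)"
  using multilinear_oper_sum[of "UNIV :: bool set" \<Omega> l "\<lambda>b. if b then T else S"] assms
  by (simp add: UNIV_bool add.commute)

lemma multilinear_oper_tensor:
  assumes T: "multilinear_oper \<Omega> l T" and S: "multilinear_oper \<Omega> j S"
  shows "multilinear_oper \<Omega> (l + j) (oper_tensor l T S)"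
proof (rule multilinear_operI)
  fix zs assume "zs \<in> coeff_tuples \<Omega> (l + j)"
  then show "continuous_on (closure \<Omega> \<times> frontier \<Omega>) (oper_tensor l T S zs)"
    unfolding oper_tensor_def
    using multilinear_operD(1)[OF T coeff_tuples_take] multilinear_operD(1)[OF S coeff_tuples_drop]
    by (intro continuous_on_mult) auto
next
  fix zs ws p
  assume *: "zs \<in> coeff_tuples \<Omega> (l + j)" "ws \<in> coeff_tuples \<Omega> (l + j)"
    "\<And>i. i < l + j \<Longrightarrow> AE x in lebesgue_on \<Omega>.
        fst (zs ! i) x = fst (ws ! i) x \<and> snd (zs ! i) x = snd (ws ! i) x"
    "p \<in> closure \<Omega> \<times> frontier \<Omega>"
  have len: "length zs = l + j" "length ws = l + j"
    using *(1,2) by (auto simp: coeff_tuples_def)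
  have "T (take l zs) p = T (take l ws) p"
    by (rule multilinear_operD(2)[OF T]) (use * len coeff_tuples_take in auto)
  moreover have "S (drop l zs) p = S (drop l ws) p"
    by (rule multilinear_operD(2)[OF S]) (use * len coeff_tuples_drop in auto)
  ultimately show "oper_tensor l T S zs p = oper_tensor l T S ws p"
    by (simp add: oper_tensor_def)
next
  fix zs i \<zeta> \<xi> c d p
  assume *: "zs \<in> coeff_tuples \<Omega> (l + j)" "i < l + j" "\<zeta> \<in> Linf \<Omega> \<times> Linf \<Omega>"
    "\<xi> \<in> Linf \<Omega> \<times> Linf \<Omega>" "p \<in> closure \<Omega> \<times> frontier \<Omega>"
  show "oper_tensor l T S (zs[i := coeff_lincomb c \<zeta> d \<xi>]) p =
      c * oper_tensor l T S (zs[i := \<zeta>]) p + d * oper_tensor l T S (zs[i := \<xi>]) p"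
  \<comment> \<open>Each slot belongs to exactly one factor, and the other factor stays fixed. Slots
    of the right factor are shifted by \<open>l\<close>.\<close>
  proof (cases "i < l")
    case True
    then show ?thesis
      using multilinear_operD(3)[OF T coeff_tuples_take[OF *(1)] True *(3-5), of c d]
      by (simp add: oper_tensor_def take_update_swap algebra_simps)
  next
    case False
    then have "i - l < j"
      using *(2) by simp
    then show ?thesis
      using multilinear_operD(3)[OF S coeff_tuples_drop[OF *(1)] _ *(3-5), of "i - l" c d] False
      by (simp add: oper_tensor_def drop_update_swap algebra_simps)
  qed
qed

text \<open>A pointwise form of the bound, free of quotients and covering arguments of norm 0 as
  well. It passes through sums, tensor products and integrals, and \<open>oper_bound_le\<close>
  converts it back.\<close>

definition oper_le :: "'a::euclidean_space set \<Rightarrow> nat \<Rightarrow> 'a oper \<Rightarrow> real \<Rightarrow> bool" where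
  "oper_le \<Omega> l T c \<longleftrightarrow> (\<forall>zs\<in>coeff_tuples \<Omega> l. \<forall>p\<in>closure \<Omega> \<times> frontier \<Omega>.
     \<bar>T zs p\<bar> \<le> c * (\<Prod>\<zeta>\<leftarrow>zs. coeff_norm \<Omega> \<zeta>))"

lemma prod_coeff_norm_nonneg: "0 \<le> (\<Prod>\<zeta>\<leftarrow>zs. coeff_norm \<Omega> \<zeta>)"
  by (induction zs) (auto simp: coeff_norm_nonneg)

lemma prod_coeff_norm_pos:
  "(\<forall>\<zeta>\<in>set zs. coeff_norm \<Omega> \<zeta> \<noteq> 0) \<Longrightarrow> 0 < (\<Prod>\<zeta>\<leftarrow>zs. coeff_norm \<Omega> \<zeta>)"
  by (induction zs) (auto simp: coeff_norm_nonneg order.not_eq_order_implies_strict)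

lemma oper_le_sum:
  assumes "\<And>i. i \<in> I \<Longrightarrow> oper_le \<Omega> l (T i) (c i)"
  shows "oper_le \<Omega> l (\<lambda>zs p. \<Sum>i\<in>I. T i zs p) (\<Sum>i\<in>I. c i)"
  unfolding oper_le_def sum_distrib_right
  using assms by (auto simp: oper_le_def intro!: order.trans[OF sum_abs] sum_mono)

lemma oper_le_add:
  assumes "oper_le \<Omega> l T c" "oper_le \<Omega> l S d"
  shows "oper_le \<Omega> l (\<lambda>zs p. T zs p + S zs p) (c + d)"
  using assms unfolding oper_le_def distrib_right
  by (meson abs_triangle_ineq add_mono order.trans)

lemma oper_le_tensor:
  assumes "oper_le \<Omega> l T c" "oper_le \<Omega> j S d" "0 \<le> c"
  shows "oper_le \<Omega> (l + j) (oper_tensor l T S) (c * d)"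
  unfolding oper_le_def
proof (intro ballI)
  fix zs p
  assume *: "zs \<in> coeff_tuples \<Omega> (l + j)" "p \<in> closure \<Omega> \<times> frontier \<Omega>"
  have "\<bar>T (take l zs) p\<bar> * \<bar>S (drop l zs) p\<bar> \<le>
      (c * (\<Prod>\<zeta>\<leftarrow>take l zs. coeff_norm \<Omega> \<zeta>)) * (d * (\<Prod>\<zeta>\<leftarrow>drop l zs. coeff_norm \<Omega> \<zeta>))"
    by (intro mult_mono)
       (use assms * coeff_tuples_take[OF *(1)] coeff_tuples_drop[OF *(1)] prod_coeff_norm_nonneg in
         \<open>auto simp: oper_le_def intro!: mult_nonneg_nonneg\<close>)
  also have "\<dots> = c * d * (\<Prod>\<zeta>\<leftarrow>take l zs @ drop l zs. coeff_norm \<Omega> \<zeta>)"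
    unfolding map_append prod_list.append by simp
  finally show "\<bar>oper_tensor l T S zs p\<bar> \<le> c * d * (\<Prod>\<zeta>\<leftarrow>zs. coeff_norm \<Omega> \<zeta>)"
    by (simp add: oper_tensor_def abs_mult)
qed

section \<open>Potentials as multilinear operators\<close>

context green_kernel
begin

text \<open>The operators \<open>op_A\<close> and \<open>op_B\<close> differ only in the component
  of the last argument that serves as density. The selector \<open>\<pi>\<close> lets one proof
  treat both.\<close>

definition potential_oper ::
    "real \<Rightarrow> ('a coeff \<Rightarrow> 'a \<Rightarrow> real) \<Rightarrow> 'a oper \<Rightarrow> 'a oper" where
  "potential_oper k \<pi> T zs = (\<lambda>(x, s). - k\<^sup>2 *
     (LINT y|lebesgue_on \<Omega>. G x y * \<pi> (last zs) y * T (butlast zs) (y, s)))"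

lemma op_A_eq: "op_A \<Omega> k G T = potential_oper k fst T"
  and op_B_eq: "op_B \<Omega> k G T = potential_oper k snd T"
  by (simp_all add: fun_eq_iff op_A_def op_a_def op_B_def op_b_def potential_oper_def)

lemma section_continuous:
  assumes "continuous_on (closure \<Omega> \<times> frontier \<Omega>) v" "s \<in> frontier \<Omega>"
  shows "continuous_on (closure \<Omega>) (\<lambda>y. v (y, s))"
  by (rule continuous_on_compose2[OF assms(1)]) (use assms(2) in \<open>auto intro!: continuous_intros\<close>)

lemma potential_integrable:
  assumes "x \<in> closure \<Omega>" "s \<in> frontier \<Omega>" "\<alpha> \<in> Linf \<Omega>"
    and v: "continuous_on (closure \<Omega> \<times> frontier \<Omega>) v"
  shows "integrable (lebesgue_on \<Omega>) (\<lambda>y. G x y * \<alpha> y * v (y, s))"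
proof -
  have "bounded (v ` (closure \<Omega> \<times> frontier \<Omega>))"
    by (intro compact_imp_bounded compact_continuous_image v compact_domain)
  then obtain B where "\<And>p. p \<in> closure \<Omega> \<times> frontier \<Omega> \<Longrightarrow> \<bar>v p\<bar> \<le> B"
    by (auto simp: bounded_iff)
  then show ?thesis
    using assms by (intro density_integrable(1)[where B = B] section_continuous) auto
qed

text \<open>The new last argument enters as the density, the earlier ones through \<open>T\<close>.
  Continuity comes from \<open>potential_continuous\<close>; the other two properties hold for the
  integrands and survive integration.\<close>

lemma multilinear_potential_oper:
  assumes T: "multilinear_oper \<Omega> l T" and \<pi>: "\<pi> = fst \<or> \<pi> = snd"
  shows "multilinear_oper \<Omega> (Suc l) (potential_oper k \<pi> T)"
proof (rule multilinear_operI)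
  fix zs assume "zs \<in> coeff_tuples \<Omega> (Suc l)"
  note zs = coeff_tuples_Suc[OF this]
  have "continuous_on (closure \<Omega> \<times> frontier \<Omega>) (\<lambda>(x, s). LINT y|lebesgue_on \<Omega>.
      G x y * \<pi> (last zs) y * T (butlast zs) (y, s))"
    by (rule potential_continuous) (use \<pi> zs compact_frontier_dom multilinear_operD(1)[OF T] in auto)
  then have "continuous_on (closure \<Omega> \<times> frontier \<Omega>) (\<lambda>q. - k\<^sup>2 * (case q of (x, s) \<Rightarrow>
      LINT y|lebesgue_on \<Omega>. G x y * \<pi> (last zs) y * T (butlast zs) (y, s)))"
    by (rule continuous_on_mult_left)
  then show "continuous_on (closure \<Omega> \<times> frontier \<Omega>) (potential_oper k \<pi> T zs)"
    by (simp add: potential_oper_def case_prod_beta)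
next
  fix zs ws p
  assume *: "zs \<in> coeff_tuples \<Omega> (Suc l)" "ws \<in> coeff_tuples \<Omega> (Suc l)"
    and ae: "\<And>i. i < Suc l \<Longrightarrow> AE x in lebesgue_on \<Omega>.
        fst (zs ! i) x = fst (ws ! i) x \<and> snd (zs ! i) x = snd (ws ! i) x"
    and p: "p \<in> closure \<Omega> \<times> frontier \<Omega>"
  note zs = coeff_tuples_Suc[OF *(1)] and ws = coeff_tuples_Suc[OF *(2)]
  obtain x s where xs: "p = (x, s)" "x \<in> closure \<Omega>" "s \<in> frontier \<Omega>"
    using p by auto
  have eq: "T (butlast zs) (y, s) = T (butlast ws) (y, s)" if "y \<in> closure \<Omega>" for y
    by (rule multilinear_operD(2)[OF T zs(1) ws(1)])
       (use ae zs(3) ws(3) that xs in \<open>auto simp: nth_butlast\<close>)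
  have "AE y in lebesgue_on \<Omega>. \<pi> (last zs) y = \<pi> (last ws) y"
    using ae[of l] \<pi> zs(3) ws(3) zs(4) ws(4) by (auto simp: last_conv_nth elim: eventually_mono)
  then have "AE y in lebesgue_on \<Omega>.
      G x y * \<pi> (last zs) y * T (butlast zs) (y, s) = G x y * \<pi> (last ws) y * T (butlast ws) (y, s)"
    using AE_dom by eventually_elim (use eq dom_subset_closure in simp)
  then have "(LINT y|lebesgue_on \<Omega>. G x y * \<pi> (last zs) y * T (butlast zs) (y, s)) =
      (LINT y|lebesgue_on \<Omega>. G x y * \<pi> (last ws) y * T (butlast ws) (y, s))"
    by (intro integral_cong_AE borel_measurable_integrable potential_integrable
        multilinear_operD(1)[OF T]) (use xs \<pi> zs ws in auto)
  then show "potential_oper k \<pi> T zs p = potential_oper k \<pi> T ws p"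
    by (simp add: potential_oper_def xs)
next
  fix zs i \<zeta> \<xi> c d p
  assume *: "zs \<in> coeff_tuples \<Omega> (Suc l)" "i < Suc l"
    and \<zeta>\<xi>: "\<zeta> \<in> Linf \<Omega> \<times> Linf \<Omega>" "\<xi> \<in> Linf \<Omega> \<times> Linf \<Omega>"
    and p: "p \<in> closure \<Omega> \<times> frontier \<Omega>"
  note zs = coeff_tuples_Suc[OF *(1)]
  obtain x s where xs: "p = (x, s)" "x \<in> closure \<Omega>" "s \<in> frontier \<Omega>"
    using p by auto
  let ?f = "\<lambda>zs y. G x y * \<pi> (last zs) y * T (butlast zs) (y, s)"
  have i: "integrable (lebesgue_on \<Omega>) (?f (zs[i := \<eta>]))" if "\<eta> \<in> Linf \<Omega> \<times> Linf \<Omega>" for \<eta>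
    using coeff_tuples_Suc[OF coeff_tuples_update[OF *(1) that]]
    by (intro potential_integrable xs multilinear_operD(1)[OF T]) (use \<pi> in \<open>auto simp: mem_Times_iff\<close>)
  have "?f (zs[i := coeff_lincomb c \<zeta> d \<xi>]) y = c * ?f (zs[i := \<zeta>]) y + d * ?f (zs[i := \<xi>]) y"
    if y: "y \<in> \<Omega>" for y
  \<comment> \<open>The last slot acts linearly on the density. An earlier slot leaves the density
    alone and acts through \<open>T\<close>.\<close>
  proof (cases "i = l")
    case True
    have "\<pi> (coeff_lincomb c \<zeta> d \<xi>) y = c * \<pi> \<zeta> y + d * \<pi> \<xi> y"
      using \<pi> by (auto simp: coeff_lincomb_def)
    then show ?thesis
      using zs(3,4) True by (simp add: butlast_list_update last_list_update algebra_simps)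
  next
    case False
    then have "i < l"
      using *(2) by simp
    then have "T ((butlast zs)[i := coeff_lincomb c \<zeta> d \<xi>]) (y, s) =
        c * T ((butlast zs)[i := \<zeta>]) (y, s) + d * T ((butlast zs)[i := \<xi>]) (y, s)"
      by (intro multilinear_operD(3)[OF T zs(1)] \<zeta>\<xi>) (use xs y dom_subset_closure in auto)
    then show ?thesis
      using zs(3,4) False by (simp add: butlast_list_update last_list_update algebra_simps)
  qed
  then have "(LINT y|lebesgue_on \<Omega>. ?f (zs[i := coeff_lincomb c \<zeta> d \<xi>]) y) =
      (LINT y|lebesgue_on \<Omega>. c * ?f (zs[i := \<zeta>]) y + d * ?f (zs[i := \<xi>]) y)"
    by (intro Bochner_Integration.integral_cong) auto
  also have "\<dots> = c * (LINT y|lebesgue_on \<Omega>. ?f (zs[i := \<zeta>]) y) +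
      d * (LINT y|lebesgue_on \<Omega>. ?f (zs[i := \<xi>]) y)"
    using i[OF \<zeta>\<xi>(1)] i[OF \<zeta>\<xi>(2)] by simp
  finally show "potential_oper k \<pi> T (zs[i := coeff_lincomb c \<zeta> d \<xi>]) p =
      c * potential_oper k \<pi> T (zs[i := \<zeta>]) p + d * potential_oper k \<pi> T (zs[i := \<xi>]) p"
    by (simp add: potential_oper_def xs algebra_simps)
qed

text \<open>The bound of \<open>T\<close> controls the field, the norm of the last argument controls
  the density, and what remains is \<open>k\<^sup>2\<close> times the kernel mass at
  \<open>x\<close>.\<close>

lemma oper_le_potential_oper:
  assumes T: "multilinear_oper \<Omega> l T" and \<pi>: "\<pi> = fst \<or> \<pi> = snd"
    and le: "oper_le \<Omega> l T c" and c: "0 \<le> c"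
  shows "oper_le \<Omega> (Suc l) (potential_oper k \<pi> T) (green_mu \<Omega> k G * c)"
  unfolding oper_le_def
proof (intro ballI)
  fix zs p
  assume *: "zs \<in> coeff_tuples \<Omega> (Suc l)" "p \<in> closure \<Omega> \<times> frontier \<Omega>"
  note zs = coeff_tuples_Suc[OF *(1)]
  obtain x s where xs: "p = (x, s)" "x \<in> closure \<Omega>" "s \<in> frontier \<Omega>"
    using *(2) by auto
  define B where "B = c * (\<Prod>\<zeta>\<leftarrow>butlast zs. coeff_norm \<Omega> \<zeta>)"
  have B: "0 \<le> B"
    unfolding B_def by (intro mult_nonneg_nonneg c prod_coeff_norm_nonneg)
  have "\<bar>LINT y|lebesgue_on \<Omega>. G x y * \<pi> (last zs) y * T (butlast zs) (y, s)\<bar> \<le>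
      (LINT y|lebesgue_on \<Omega>. \<bar>G x y\<bar>) * Linf_norm \<Omega> (\<pi> (last zs)) * B"
    by (rule density_integrable(2))
       (use xs \<pi> zs le section_continuous[OF multilinear_operD(1)[OF T]] in
         \<open>auto simp: oper_le_def B_def\<close>)
  also have "\<dots> \<le> (LINT y|lebesgue_on \<Omega>. \<bar>G x y\<bar>) * coeff_norm \<Omega> (last zs) * B"
    using \<pi> B by (intro mult_right_mono mult_left_mono) (auto simp: coeff_norm_def)
  finally have "k\<^sup>2 * \<bar>LINT y|lebesgue_on \<Omega>. G x y * \<pi> (last zs) y * T (butlast zs) (y, s)\<bar> \<le>
      k\<^sup>2 * ((LINT y|lebesgue_on \<Omega>. \<bar>G x y\<bar>) * coeff_norm \<Omega> (last zs) * B)"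
    by (intro mult_left_mono) auto
  also have "\<dots> = (k\<^sup>2 * (LINT y|lebesgue_on \<Omega>. \<bar>G x y\<bar>)) * (coeff_norm \<Omega> (last zs) * B)"
    by simp
  also have "\<dots> \<le> green_mu \<Omega> k G * (coeff_norm \<Omega> (last zs) * B)"
    by (intro mult_right_mono kernel_mass_le_green_mu xs mult_nonneg_nonneg coeff_norm_nonneg B)
  also have "\<dots> = green_mu \<Omega> k G * c * (\<Prod>\<zeta>\<leftarrow>butlast zs @ [last zs]. coeff_norm \<Omega> \<zeta>)"
    unfolding map_append prod_list.append by (simp add: B_def)
  finally show "\<bar>potential_oper k \<pi> T zs p\<bar> \<le> green_mu \<Omega> k G * c * (\<Prod>\<zeta>\<leftarrow>zs. coeff_norm \<Omega> \<zeta>)"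
    using zs(4) by (simp add: potential_oper_def xs(1) abs_mult)
qed

section \<open>Supremum norms and induction on the order\<close>

lemma C_norm_upper:
  assumes "continuous_on (closure \<Omega> \<times> frontier \<Omega>) v" "p \<in> closure \<Omega> \<times> frontier \<Omega>"
  shows "\<bar>v p\<bar> \<le> C_norm \<Omega> v"
  unfolding C_norm_def
  by (intro cSUP_upper bounded_imp_bdd_above compact_imp_bounded compact_continuous_image
      compact_domain continuous_on_rabs assms)

text \<open>This makes the suprema in \<open>C_norm\<close> range over a nonempty set, as
  \<open>cSUP_least\<close> requires.\<close>

lemma domain_nonempty: "closure \<Omega> \<times> frontier \<Omega> \<noteq> {}"
  using frontier_nonempty nonempty_dom by simp

lemma C_norm_nonneg:
  assumes "continuous_on (closure \<Omega> \<times> frontier \<Omega>) v"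
  shows "0 \<le> C_norm \<Omega> v"
  using C_norm_upper[OF assms] domain_nonempty abs_ge_zero order.trans by blast

text \<open>Tuples with an entry of norm 0 are excluded from the supremum, so the product of norms
  is positive and the pointwise bound can be divided by it.\<close>

lemma oper_bound_le:
  assumes "oper_le \<Omega> l T c"
  shows "oper_bound \<Omega> l T \<le> ereal c"
  unfolding oper_bound_def
proof (rule SUP_least)
  fix zs
  assume *: "zs \<in> {zs \<in> coeff_tuples \<Omega> l. \<forall>\<zeta>\<in>set zs. coeff_norm \<Omega> \<zeta> \<noteq> 0}"
  have "C_norm \<Omega> (T zs) \<le> c * (\<Prod>\<zeta>\<leftarrow>zs. coeff_norm \<Omega> \<zeta>)"
    unfolding C_norm_def
    by (rule cSUP_least[OF domain_nonempty]) (use assms * in \<open>auto simp: oper_le_def\<close>)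
  then show "ereal (C_norm \<Omega> (T zs) / (\<Prod>\<zeta>\<leftarrow>zs. coeff_norm \<Omega> \<zeta>)) \<le> ereal c"
    using prod_coeff_norm_pos[of zs \<Omega>] * by (simp add: divide_le_eq)
qed

text \<open>The induction is strong because the cubic term involves all lower orders. Both claims
  are proved together: estimating a potential requires the continuity that multilinearity of the
  previous operators includes.\<close>

lemma forward_oper_multilinear_bound:
  fixes k :: real
  assumes u: "continuous_on (closure \<Omega> \<times> frontier \<Omega>) u"
  shows "multilinear_oper \<Omega> n (forward_oper \<Omega> k G u n) \<and>
    oper_le \<Omega> n (forward_oper \<Omega> k G u n) (nu_seq (C_norm \<Omega> u) n * green_mu \<Omega> k G ^ n)"
proof (induction n rule: less_induct)
  case (less n)
  define \<mu> where "\<mu> = green_mu \<Omega> k G"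
  define K where "K n = forward_oper \<Omega> k G u n" for n
  define \<nu> where "\<nu> n = nu_seq (C_norm \<Omega> u) n" for n
  have \<mu>: "0 \<le> \<mu>"
    by (simp add: \<mu>_def green_mu_nonneg)
  have \<nu>: "0 \<le> \<nu> i" for i
    by (simp add: \<nu>_def nu_seq_nonneg C_norm_nonneg[OF u])
  have "multilinear_oper \<Omega> n (K n) \<and> oper_le \<Omega> n (K n) (\<nu> n * \<mu> ^ n)"
  proof (cases n)
    case 0
    have K0: "K 0 = (\<lambda>zs. u)"
      by (simp add: K_def)
    have "multilinear_oper \<Omega> 0 (\<lambda>zs. u)"
      by (rule multilinear_operI) (use u in auto)
    \<comment> \<open>The only tuple of order 0 is the empty list, whose product of norms is
      1.\<close>
    moreover have "oper_le \<Omega> 0 (\<lambda>zs. u) (C_norm \<Omega> u)"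
      using C_norm_upper[OF u] by (auto simp: oper_le_def coeff_tuples_def)
    ultimately show ?thesis
      using 0 by (simp add: K0 \<nu>_def)
  next
    case (Suc m)
    define I where "I = {(i\<^sub>1, i\<^sub>2, i\<^sub>3). i\<^sub>1 + i\<^sub>2 + i\<^sub>3 = m}"
    define P where "P = (\<lambda>(i\<^sub>1, i\<^sub>2, i\<^sub>3). oper_tensor (i\<^sub>1 + i\<^sub>2) (oper_tensor i\<^sub>1 (K i\<^sub>1) (K i\<^sub>2)) (K i\<^sub>3))"
    define c where "c = (\<lambda>(i\<^sub>1, i\<^sub>2, i\<^sub>3). (\<nu> i\<^sub>1 * \<mu> ^ i\<^sub>1) * (\<nu> i\<^sub>2 * \<mu> ^ i\<^sub>2) * (\<nu> i\<^sub>3 * \<mu> ^ i\<^sub>3))"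
    have IH: "multilinear_oper \<Omega> i (K i)" "oper_le \<Omega> i (K i) (\<nu> i * \<mu> ^ i)" if "i \<le> m" for i
      using less.IH[of i] Suc that by (simp_all add: K_def \<nu>_def \<mu>_def)
    have P: "multilinear_oper \<Omega> m (P t) \<and> oper_le \<Omega> m (P t) (c t)" if "t \<in> I" for t
    proof -
      obtain i j l where t: "t = (i, j, l)" "i + j + l = m"
        using \<open>t \<in> I\<close> by (auto simp: I_def)
      have *: "i \<le> m" "j \<le> m" "l \<le> m"
        using t(2) by auto
      have "multilinear_oper \<Omega> (i + j + l) (P t)"
        unfolding P_def t(1) split_conv by (intro multilinear_oper_tensor IH *)
      moreover have "oper_le \<Omega> (i + j + l) (P t) (c t)"
        unfolding P_def c_def t(1) split_conv
        by (intro oper_le_tensor IH * mult_nonneg_nonneg \<nu> zero_le_power \<mu>)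
      ultimately show ?thesis
        by (simp add: t(2))
    qed
    define S where "S = (\<lambda>zs p. \<Sum>t\<in>I. P t zs p)"
    have S: "multilinear_oper \<Omega> m S" "oper_le \<Omega> m S (\<Sum>t\<in>I. c t)"
      unfolding S_def using P by (auto intro: multilinear_oper_sum oper_le_sum)
    have "0 \<le> (\<Sum>t\<in>I. c t)"
      using \<nu> \<mu> by (auto simp: c_def intro!: sum_nonneg)
    note AB = multilinear_potential_oper[OF IH(1)[OF order_refl], of fst k]
      multilinear_potential_oper[OF S(1), of snd k]
      oper_le_potential_oper[OF IH(1)[OF order_refl] _ IH(2)[OF order_refl], of fst k]
      oper_le_potential_oper[OF S(1) _ S(2) this, of snd k]
    have K: "K n = (\<lambda>zs p. potential_oper k fst (K m) zs p + potential_oper k snd S zs p)"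
      unfolding Suc K_def forward_oper.simps op_A_eq op_B_eq
      by (simp add: S_def P_def I_def K_def case_prod_beta)
    \<comment> \<open>The three indices add up to \<open>m\<close>, so the powers of
      \<open>\<mu>\<close> collect to \<open>\<mu> ^ m\<close>. The potential contributes one more
      factor, and the coefficients then satisfy the recursion of \<open>nu_seq\<close>.\<close>
    have "(\<Sum>t\<in>I. c t) = (\<Sum>(i\<^sub>1, i\<^sub>2, i\<^sub>3)\<in>I. \<nu> i\<^sub>1 * \<nu> i\<^sub>2 * \<nu> i\<^sub>3) * \<mu> ^ m"
      unfolding sum_distrib_right by (rule sum.cong) (auto simp: c_def I_def power_add)
    then have "\<mu> * (\<nu> m * \<mu> ^ m) + \<mu> * (\<Sum>t\<in>I. c t) = \<nu> n * \<mu> ^ n"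
      by (simp add: Suc \<nu>_def I_def algebra_simps)
    moreover have "oper_le \<Omega> n (K n) (\<mu> * (\<nu> m * \<mu> ^ m) + \<mu> * (\<Sum>t\<in>I. c t))"
      unfolding K unfolding Suc
      by (rule oper_le_add) (use AB(3,4) \<nu> \<mu> in \<open>simp_all add: \<mu>_def\<close>)
    moreover have "multilinear_oper \<Omega> n (K n)"
      unfolding K unfolding Suc by (rule multilinear_oper_add) (use AB(1,2) in simp_all)
    ultimately show ?thesis
      by simp
  qed
  then show ?case
    by (simp only: K_def \<nu>_def \<mu>_def)
qed

end

section \<open>Exponential bounds for all forward operators\<close>

theorem proposition2:
  fixes \<Omega> :: "'a::euclidean_space set"
    and k :: real
    and G :: "'a \<Rightarrow> 'a \<Rightarrow> real"
    and u\<^sub>0 :: "'a \<times> 'a \<Rightarrow> real"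
    and g :: "'a \<Rightarrow> 'a \<Rightarrow> real"
  assumes "DIM('a) > 2"
    and "smooth_bounded_domain \<Omega>"
    and "k > 0"
    and "neumann_green_function \<Omega> k G"
    and "green_singularity \<Omega> G"
    and "\<forall>s\<in>frontier \<Omega>. background_solution \<Omega> k (g s) (\<lambda>x. u\<^sub>0 (x, s))"
    and "continuous_on (closure \<Omega> \<times> frontier \<Omega>) u\<^sub>0"
  shows "(\<forall>n. bounded_multilinear_oper \<Omega> n (forward_oper \<Omega> k G u\<^sub>0 n)) \<and>
    (\<exists>\<nu> K. 0 < \<nu> \<and> 0 < K \<and> (\<forall>n. nu_seq (C_norm \<Omega> u\<^sub>0) n \<le> \<nu> * K ^ n)) \<and>
    (\<forall>\<nu> K. (\<forall>n. nu_seq (C_norm \<Omega> u\<^sub>0) n \<le> \<nu> * K ^ n) \<longrightarrow>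
      (\<forall>n. oper_bound \<Omega> n (forward_oper \<Omega> k G u\<^sub>0 n) \<le> ereal (\<nu> * (K * green_mu \<Omega> k G) ^ n)))"
proof -
  interpret green_kernel \<Omega> G
    using assms(1,2,5) by unfold_locales (auto simp: smooth_bounded_domain_def)
  define \<nu>\<^sub>0 where "\<nu>\<^sub>0 = C_norm \<Omega> u\<^sub>0"
  define \<mu> where "\<mu> = green_mu \<Omega> k G"
  have \<nu>\<^sub>0: "0 \<le> \<nu>\<^sub>0"
    unfolding \<nu>\<^sub>0_def by (rule C_norm_nonneg[OF assms(7)])
  have lin: "multilinear_oper \<Omega> n (forward_oper \<Omega> k G u\<^sub>0 n)"
    and bnd: "oper_bound \<Omega> n (forward_oper \<Omega> k G u\<^sub>0 n) \<le> ereal (nu_seq \<nu>\<^sub>0 n * \<mu> ^ n)" for n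
    using forward_oper_multilinear_bound[OF assms(7)] oper_bound_le by (auto simp: \<nu>\<^sub>0_def \<mu>_def)
  have "oper_bound \<Omega> n (forward_oper \<Omega> k G u\<^sub>0 n) < \<infinity>" for n
    using bnd[of n] by (rule le_less_trans) simp
  then have "bounded_multilinear_oper \<Omega> n (forward_oper \<Omega> k G u\<^sub>0 n)" for n
    using lin by (simp add: bounded_multilinear_oper_def)
  \<comment> \<open>The witnesses depend on \<open>\<nu>\<^sub>0\<close> alone: the bound on the
    partial sums and the reciprocal of the point where they are taken.\<close>
  moreover have "\<exists>\<nu> K. 0 < \<nu> \<and> 0 < K \<and> (\<forall>n. nu_seq \<nu>\<^sub>0 n \<le> \<nu> * K ^ n)"
    using nu_seq_exponential_bound[OF \<nu>\<^sub>0] \<nu>\<^sub>0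
    by (intro exI[of _ "\<nu>\<^sub>0 + 1"] exI[of _ "(\<nu>\<^sub>0 + 1) + (\<nu>\<^sub>0 + 1) ^ 3"] conjI allI)
       (simp_all add: add_pos_pos)
  moreover have "oper_bound \<Omega> n (forward_oper \<Omega> k G u\<^sub>0 n) \<le> ereal (\<nu> * (K * \<mu>) ^ n)"
    if "\<forall>n. nu_seq \<nu>\<^sub>0 n \<le> \<nu> * K ^ n" for \<nu> K n
  proof -
    \<comment> \<open>Any pair of constants dominating the sequence may be inserted, because the
      factor \<open>\<mu> ^ n\<close> is nonnegative.\<close>
    have "nu_seq \<nu>\<^sub>0 n * \<mu> ^ n \<le> \<nu> * K ^ n * \<mu> ^ n"
      using that green_mu_nonneg by (intro mult_right_mono) (auto simp: \<mu>_def)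
    then show ?thesis
      using bnd[of n] by (auto simp: power_mult_distrib mult.assoc intro: order.trans)
  qed
  ultimately show ?thesis
    unfolding \<nu>\<^sub>0_def \<mu>_def by blast
qed

end
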